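(* There is an algorithm which, given a connected graph $G$ with $n$ vertices and at least one edge, solves the minimum weighting ratio problem $\inf_{\omega\in W} t_\omega(G)$ in time polynomial in $n$.
   Context: Graphs are finite, simple and undirected. Let $W$ be the set of functions $\omega:E(G)\to\mathbb{R}_{\ge 0}$ that are not identically zero. For $\omega\in W$ let $\omega(H)=\sum_{e\in E(H)}\omega(e)$ for a subgraph $H$, and $\omega(G)=\sum_{e\in E(G)}\omega(e)$. Let $T_\omega$ be a maximum spanning tree of $G$ with respect to $\omega$, i.e. a spanning tree maximizing $\omega(T)$. The weighting ratio is $t_\omega(G)=\omega(T_\omega)/\omega(G)$. The minimum weighting ratio problem asks for $\inf_{\omega\in W}t_\omega(G)$ together with an edge-weight function attaining it. *)

theory Defs
  imports Complex_Main "HOL-Computational_Algebra.Polynomial"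
begin

section \<open>Finite simple graphs and spanning trees\<close>

text \<open>A graph is given by its vertex set and its set of two-element edges.\<close>

definition simple_graph :: "'a set \<Rightarrow> 'a set set \<Rightarrow> bool" where
  "simple_graph V E \<longleftrightarrow> finite V \<and> (\<forall>e\<in>E. \<exists>u\<in>V. \<exists>v\<in>V. u \<noteq> v \<and> e = {u, v})"

definition graph_connected :: "'a set \<Rightarrow> 'a set set \<Rightarrow> bool" where
  "graph_connected V E \<longleftrightarrow>
     V \<noteq> {} \<and> (\<forall>u\<in>V. \<forall>v\<in>V. (u, v) \<in> {(x, y). {x, y} \<in> E}\<^sup>*)"

definition graph_cycle :: "'a set set \<Rightarrow> 'a list \<Rightarrow> bool" where
  "graph_cycle E vs \<longleftrightarrow> distinct vs \<and> 3 \<le> length vs \<and>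
     (\<forall>i<length vs. {vs ! i, vs ! (Suc i mod length vs)} \<in> E)"

definition graph_tree :: "'a set \<Rightarrow> 'a set set \<Rightarrow> bool" where
  "graph_tree V T \<longleftrightarrow> simple_graph V T \<and> graph_connected V T \<and> (\<nexists>vs. graph_cycle T vs)"

definition spanning_tree_of :: "'a set \<Rightarrow> 'a set set \<Rightarrow> 'a set set \<Rightarrow> bool" where
  "spanning_tree_of V E T \<longleftrightarrow> T \<subseteq> E \<and> graph_tree V T"

section \<open>The minimum weighting ratio\<close>

text \<open>Only the values of a weighting on \<open>E\<close> are relevant.\<close>

definition weightings :: "'a set set \<Rightarrow> ('a set \<Rightarrow> real) set" where
  "weightings E = {\<omega>. (\<forall>e\<in>E. 0 \<le> \<omega> e) \<and> (\<exists>e\<in>E. \<omega> e \<noteq> 0)}"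

definition max_spanning_tree :: "'a set \<Rightarrow> 'a set set \<Rightarrow> ('a set \<Rightarrow> real) \<Rightarrow> 'a set set" where
  "max_spanning_tree V E \<omega> = arg_max (\<lambda>T. \<Sum>e\<in>T. \<omega> e) (spanning_tree_of V E)"

definition weighting_ratio :: "'a set \<Rightarrow> 'a set set \<Rightarrow> ('a set \<Rightarrow> real) \<Rightarrow> real" where
  "weighting_ratio V E \<omega> = (\<Sum>e\<in>max_spanning_tree V E \<omega>. \<omega> e) / (\<Sum>e\<in>E. \<omega> e)"

definition min_weighting_ratio :: "'a set \<Rightarrow> 'a set set \<Rightarrow> real" where
  "min_weighting_ratio V E = (INF \<omega>\<in>weightings E. weighting_ratio V E \<omega>)"

section \<open>The model of computation\<close>

text \<open>
  Structured programs for a random access machine. The memory consists of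
  arrays of natural numbers, of which a program mentions only finitely many;
  a scalar is cell 0 of an array. Evaluating each node of an expression costs one step.
  Since addition and truncated subtraction are the only arithmetic operations, the bit length
  of the numbers grows by at most a constant per step, so that polynomial
  running time in this unit-cost model agrees with polynomial time on Turing
  machines. (This would fail if multiplication were a primitive.)
\<close>

type_synonym vname = string
type_synonym state = "vname \<Rightarrow> nat \<Rightarrow> nat"

datatype aexp = Lit nat | Cell vname aexp | Add aexp aexp | Monus aexp aexp

datatype bexp = Less aexp aexp | Neg bexp | Conj bexp bexp

datatype com =
    Skip
  | Assign vname aexp aexp
  | Seq com com
  | Cond bexp com com
  | While bexp com

fun aval :: "aexp \<Rightarrow> state \<Rightarrow> nat" where
  "aval (Lit k) s = k"
| "aval (Cell x i) s = s x (aval i s)"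
| "aval (Add a b) s = aval a s + aval b s"
| "aval (Monus a b) s = aval a s - aval b s"

fun acost :: "aexp \<Rightarrow> nat" where
  "acost (Lit k) = 1"
| "acost (Cell x i) = 1 + acost i"
| "acost (Add a b) = 1 + acost a + acost b"
| "acost (Monus a b) = 1 + acost a + acost b"

fun bval :: "bexp \<Rightarrow> state \<Rightarrow> bool" where
  "bval (Less a b) s \<longleftrightarrow> aval a s < aval b s"
| "bval (Neg b) s \<longleftrightarrow> \<not> bval b s"
| "bval (Conj a b) s \<longleftrightarrow> bval a s \<and> bval b s"

fun bcost :: "bexp \<Rightarrow> nat" where
  "bcost (Less a b) = 1 + acost a + acost b"
| "bcost (Neg b) = 1 + bcost b"
| "bcost (Conj a b) = 1 + bcost a + bcost b"

text \<open>
  \<open>exec c s t s'\<close>: started in state \<open>s\<close>, program \<open>c\<close> terminates after \<open>t\<close> steps in state \<open>s'\<close>.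
\<close>

inductive exec :: "com \<Rightarrow> state \<Rightarrow> nat \<Rightarrow> state \<Rightarrow> bool" where
  exec_Skip: "exec Skip s 1 s"
| exec_Assign: "exec (Assign x i a) s (1 + acost i + acost a)
    (s(x := (s x)(aval i s := aval a s)))"
| exec_Seq: "exec c1 s1 t1 s2 \<Longrightarrow> exec c2 s2 t2 s3 \<Longrightarrow> exec (Seq c1 c2) s1 (t1 + t2) s3"
| exec_CondTrue: "bval b s \<Longrightarrow> exec c1 s t s' \<Longrightarrow> exec (Cond b c1 c2) s (1 + bcost b + t) s'"
| exec_CondFalse: "\<not> bval b s \<Longrightarrow> exec c2 s t s' \<Longrightarrow> exec (Cond b c1 c2) s (1 + bcost b + t) s'"
| exec_WhileFalse: "\<not> bval b s \<Longrightarrow> exec (While b c) s (1 + bcost b) s"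
| exec_WhileTrue: "bval b s1 \<Longrightarrow> exec c s1 t1 s2 \<Longrightarrow> exec (While b c) s2 t2 s3
    \<Longrightarrow> exec (While b c) s1 (1 + bcost b + t1 + t2) s3"

inductive_cases SkipE: "exec Skip s t s'"
inductive_cases AssignE: "exec (Assign x i a) s t s'"
inductive_cases SeqE: "exec (Seq c1 c2) s t s'"
inductive_cases CondE: "exec (Cond b c1 c2) s t s'"
inductive_cases WhileE: "exec (While b c) s t s'"

lemma exec_deterministic:
  "exec c s t s' \<Longrightarrow> exec c s u s'' \<Longrightarrow> t = u \<and> s' = s''"
proof (induction arbitrary: u s'' rule: exec.induct)
  case (exec_WhileTrue b s1 c t1 s2 t2 s3)
  from exec_WhileTrue.prems obtain v1 r v2
    where "exec c s1 v1 r" "exec (While b c) r v2 s''" "u = 1 + bcost b + v1 + v2"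
    by (rule WhileE) (use exec_WhileTrue.hyps(1) in auto)
  then show ?case using exec_WhileTrue.IH by blast
next
  case (exec_Seq c1 s1 t1 s2 c2 t2 s3)
  from exec_Seq.prems obtain v1 r v2
    where "exec c1 s1 v1 r" "exec c2 r v2 s''" "u = v1 + v2"
    by (rule SeqE) auto
  then show ?case using exec_Seq.IH by blast
next
  case (exec_Skip s)
  then show ?case by (rule SkipE) simp
next
  case (exec_Assign x i a s)
  then show ?case by (rule AssignE) simp
next
  case (exec_CondTrue b s c1 t s' c2)
  from exec_CondTrue.prems obtain v where "exec c1 s v s''" "u = 1 + bcost b + v"
    by (rule CondE) (use exec_CondTrue.hyps(1) in auto)
  then show ?case using exec_CondTrue.IH by blast
next
  case (exec_CondFalse b s c2 t s' c1)
  from exec_CondFalse.prems obtain v where "exec c2 s v s''" "u = 1 + bcost b + v"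
    by (rule CondE) (use exec_CondFalse.hyps(1) in auto)
  then show ?case using exec_CondFalse.IH by blast
next
  case (exec_WhileFalse b s c)
  from exec_WhileFalse.prems show ?case
    by (rule WhileE) (use exec_WhileFalse.hyps in simp_all)
qed

section \<open>Input and output conventions\<close>

text \<open>
  A graph on the vertices \<open>0, \<dots>, n - 1\<close> is presented by \<open>n\<close> and a list of its
  edges, each edge occurring once, with its endpoints in either order.
\<close>

definition edge_listing :: "(nat \<times> nat) list \<Rightarrow> nat set set \<Rightarrow> bool" where
  "edge_listing es E \<longleftrightarrow>
     distinct (map (\<lambda>(u, v). {u, v}) es) \<and> set (map (\<lambda>(u, v). {u, v}) es) = E"

definition input_state :: "nat \<Rightarrow> (nat \<times> nat) list \<Rightarrow> state" where
  "input_state n es = (\<lambda>x i.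
     if x = ''n'' \<and> i = 0 then n
     else if x = ''m'' \<and> i = 0 then length es
     else if x = ''src'' \<and> i < length es then fst (es ! i)
     else if x = ''dst'' \<and> i < length es then snd (es ! i)
     else 0)"

text \<open>
  The output is the infimum, as a fraction, and an optimal weighting, as one
  fraction for each edge of the input list.
\<close>

definition solves_min_weighting_ratio ::
    "nat set \<Rightarrow> nat set set \<Rightarrow> (nat \<times> nat) list \<Rightarrow> state \<Rightarrow> bool" where
  "solves_min_weighting_ratio V E es s \<longleftrightarrow>
     s ''den'' 0 > 0 \<and>
     real (s ''num'' 0) / real (s ''den'' 0) = min_weighting_ratio V E \<and>
     (\<exists>\<omega>\<in>weightings E.
        weighting_ratio V E \<omega> = min_weighting_ratio V E \<and>
        (\<forall>k<length es. s ''wden'' k > 0 \<and>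
           \<omega> {fst (es ! k), snd (es ! k)} = real (s ''wnum'' k) / real (s ''wden'' k)))"

end

theory Submission imports Defs begin

text \<open>
  Maintain a family of \<open>K = m\<^sup>3\<close> connected spanning edge sets, where \<open>m\<close> is the number of edges, and let
  the load of an edge be the number of members containing it. As long as possible, replace some
  member \<open>T\<close> by \<open>T + f - e\<close>, provided this is still connected and either \<open>f = e\<close> or the load of \<open>f\<close> is
  smaller than that of \<open>e\<close> by at least 2. Each move decreases the sum of the squared loads, so this
  stops after polynomially many moves, and then all members are spanning trees.

  Averaging over the family, every weighting has ratio at least \<open>l / K\<close>, where \<open>l\<close> is the minimum load.
  Conversely, \<open>m\<close> edges cannot occupy all the loads \<open>l, \<dots>, l + m\<close>, so some \<open>j < l + m\<close> has edges of load
  at most \<open>j\<close> but none of load \<open>j + 1\<close>. No single exchange can increase the intersection of a member with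
  the set \<open>L\<close> of edges of load at most \<open>j\<close>, hence by symmetric exchange every member is a maximum spanning
  tree for the indicator of \<open>L\<close>, whose ratio is therefore at most \<open>j / K \<le> (l + m - 1) / K\<close>. Letting \<open>K\<close> tend
  to infinity shows that the infimum is attained by an indicator, so it is a fraction with
  denominator at most \<open>m\<close>; as two different such fractions are at least \<open>1 / m\<^sup>2\<close> apart, \<open>K = m\<^sup>3\<close> makes
  the indicator of \<open>L\<close> exactly optimal.
\<close>

section \<open>Connectivity and spanning trees\<close>

definition adj :: "'a set set \<Rightarrow> ('a \<times> 'a) set" where
  "adj E = {(x, y). {x, y} \<in> E}"

lemma adj_iff [simp]: "(x, y) \<in> adj E \<longleftrightarrow> {x, y} \<in> E"
  by (simp add: adj_def)

lemma adj_rtrancl_edge: "{x, y} \<in> E \<Longrightarrow> (x, y) \<in> (adj E)\<^sup>*"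
  by (simp add: r_into_rtrancl)

lemma adj_rtrancl_step: "(x, y) \<in> (adj E)\<^sup>* \<Longrightarrow> {y, z} \<in> E \<Longrightarrow> (x, z) \<in> (adj E)\<^sup>*"
  by (simp add: rtrancl_into_rtrancl)

lemma sym_adj_rtrancl: "(x, y) \<in> (adj E)\<^sup>* \<Longrightarrow> (y, x) \<in> (adj E)\<^sup>*"
  by (metis (mono_tags, lifting) adj_iff insert_commute symD symI sym_rtrancl)

lemma adj_rtrancl_mono: "A \<subseteq> B \<Longrightarrow> (x, y) \<in> (adj A)\<^sup>* \<Longrightarrow> (x, y) \<in> (adj B)\<^sup>*"
  using rtrancl_mono[of "adj A" "adj B"] by (auto simp: adj_def)

lemma graph_connected_iff:
  "graph_connected V E \<longleftrightarrow> V \<noteq> {} \<and> (\<forall>u\<in>V. \<forall>v\<in>V. (u, v) \<in> (adj E)\<^sup>*)"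
  by (simp add: graph_connected_def adj_def)

lemma adj_rtrancl_invariant:
  assumes "(x, y) \<in> (adj E)\<^sup>*" "\<And>a b. {a, b} \<in> E \<Longrightarrow> c a = c b"
  shows "c x = c y"
  using assms(1) by induction (use assms(2) in auto)

text \<open>Each traversal of \<open>{u, v}\<close> is replaced by a detour through
  \<open>B\<close>. This is how edges are traded below, on cycles and in both halves of the
  exchange.\<close>

lemma graph_connected_insert_imp:
  assumes "graph_connected V (insert {u, v} A)" "A \<subseteq> B" "(u, v) \<in> (adj B)\<^sup>*"
  shows "graph_connected V B"
proof -
  have "(x, y) \<in> (adj B)\<^sup>*" if "(x, y) \<in> (adj (insert {u, v} A))\<^sup>*" for x y
    using that
  proof induction
    case (step y z)
    have "(y, z) \<in> (adj B)\<^sup>*"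
    proof (cases "{y, z} = {u, v}")
      case True
      then show ?thesis using assms(3) sym_adj_rtrancl by (auto simp: doubleton_eq_iff)
    next
      case False
      then show ?thesis using step(2) assms(2) by (intro adj_rtrancl_edge) auto
    qed
    then show ?case using step(3) by simp
  qed simp
  then show ?thesis using assms(1) by (auto simp: graph_connected_iff)
qed

text \<open>Traversing \<open>e\<close> would visit its endpoint \<open>w\<close>.\<close>

lemma adj_path_avoiding:
  assumes "successively (\<lambda>a b. {a, b} \<in> E) ps" "ps \<noteq> []" "w \<notin> set ps" "w \<in> e"
  shows "(hd ps, last ps) \<in> (adj (E - {e}))\<^sup>*"
  using assms(1-3)
proof (induction ps)
  case (Cons x ps)
  show ?case
  proof (cases ps)
    case (Cons y qs)
    have "(x, y) \<in> adj (E - {e})" using Cons Cons.prems assms(4) by auto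
    moreover have "(y, last ps) \<in> (adj (E - {e}))\<^sup>*" using Cons Cons.IH Cons.prems by auto
    ultimately show ?thesis using Cons by (auto intro: converse_rtrancl_into_rtrancl)
  qed simp
qed simp

text \<open>The path is built backwards from \<open>v\<close>; when the new first vertex already
  occurs, the path is cut back to start at that occurrence.\<close>

lemma adj_distinct_path:
  assumes "(u, v) \<in> (adj E)\<^sup>*"
  obtains ps where "distinct ps" "ps \<noteq> []" "hd ps = u" "last ps = v"
    "successively (\<lambda>a b. {a, b} \<in> E) ps"
proof -
  have "\<exists>ps. distinct ps \<and> ps \<noteq> [] \<and> hd ps = u \<and> last ps = v \<and> successively (\<lambda>a b. {a, b} \<in> E) ps"
    using assms
  proof (induction rule: converse_rtrancl_induct)
    case base
    show ?case by (rule exI[of _ "[v]"]) simp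
  next
    case (step x y)
    then obtain ps where ps: "distinct ps" "ps \<noteq> []" "hd ps = y" "last ps = v"
      "successively (\<lambda>a b. {a, b} \<in> E) ps" by blast
    show ?case
    proof (cases "x \<in> set ps")
      case True
      then obtain as bs where "ps = as @ x # bs" by (meson split_list)
      then show ?thesis using ps
        by (intro exI[of _ "x # bs"]) (auto simp: successively_append_iff)
    next
      case False
      then show ?thesis using ps step(1)
        by (intro exI[of _ "x # ps"]) (auto simp: successively_Cons)
    qed
  qed
  then show ?thesis using that by blast
qed

section \<open>Cycles, bridges and deletable edges\<close>

text \<open>The edge closing the cycle can go, since the rest of the cycle still joins its
  ends.\<close>

lemma graph_cycle_remove_edge:
  assumes "graph_connected V T" "graph_cycle T vs"
  shows "\<exists>e\<in>T. graph_connected V (T - {e})"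
proof -
  let ?l = "length vs"
  have vs: "distinct vs" "3 \<le> ?l" and ed: "\<And>i. i < ?l \<Longrightarrow> {vs ! i, vs ! (Suc i mod ?l)} \<in> T"
    using assms(2) by (auto simp: graph_cycle_def)
  define e where "e = {vs ! (?l - 1), vs ! 0}"
  have l: "Suc (?l - 1) = ?l" "?l - 1 < ?l" using vs by linarith+
  then have eT: "e \<in> T" using ed[of "?l - 1"] by (simp add: e_def)
  have "(vs ! 0, vs ! i) \<in> (adj (T - {e}))\<^sup>*" if "i < ?l" for i
    using that
  proof (induction i)
    case (Suc i)
    have "{vs ! i, vs ! Suc i} \<in> T" using ed[of i] Suc by simp
    \<comment> \<open>The length of at least 3 matters here: on two vertices the way forth would be
      the closing edge itself.\<close>
    moreover have "{vs ! i, vs ! Suc i} \<noteq> e"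
    proof
      assume "{vs ! i, vs ! Suc i} = e"
      then have "vs ! i = vs ! (?l - 1) \<or> vs ! i = vs ! 0 \<and> vs ! Suc i = vs ! (?l - 1)"
        by (auto simp: e_def doubleton_eq_iff)
      then have "i = ?l - 1 \<or> i = 0 \<and> Suc i = ?l - 1"
        using nth_eq_iff_index_eq[OF vs(1), of i "?l - 1"] nth_eq_iff_index_eq[OF vs(1), of i 0]
          nth_eq_iff_index_eq[OF vs(1), of "Suc i" "?l - 1"] Suc.prems vs(2) by linarith
      then show False using Suc.prems vs(2) by linarith
    qed
    ultimately have "{vs ! i, vs ! Suc i} \<in> T - {e}" by simp
    moreover have "(vs ! 0, vs ! i) \<in> (adj (T - {e}))\<^sup>*" using Suc by simp
    ultimately show ?case by (rule adj_rtrancl_step[rotated])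
  qed simp
  then have "(vs ! (?l - 1), vs ! 0) \<in> (adj (T - {e}))\<^sup>*"
    using l(2) by (simp add: sym_adj_rtrancl)
  moreover have "insert {vs ! (?l - 1), vs ! 0} (T - {e}) = T" using eT by (auto simp: e_def)
  ultimately have "graph_connected V (T - {e})"
    using graph_connected_insert_imp[of V "vs ! (?l - 1)" "vs ! 0" "T - {e}" "T - {e}"] assms(1)
    by simp
  then show ?thesis using eT by blast
qed

text \<open>A simple detour from \<open>u\<close> to \<open>v\<close> is closed by the edge to a
  cycle. It has at least three vertices, because a path on two would use the deleted edge.\<close>

lemma bridge_of_acyclic:
  assumes "\<nexists>vs. graph_cycle T vs" "{u, v} \<in> T" "u \<noteq> v"
  shows "(u, v) \<notin> (adj (T - {{u, v}}))\<^sup>*"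
proof
  assume "(u, v) \<in> (adj (T - {{u, v}}))\<^sup>*"
  then obtain ps where ps: "distinct ps" "ps \<noteq> []" "hd ps = u" "last ps = v"
    "successively (\<lambda>a b. {a, b} \<in> T - {{u, v}}) ps" by (rule adj_distinct_path)
  have suc: "{ps ! i, ps ! Suc i} \<in> T - {{u, v}}" if "Suc i < length ps" for i
    using ps(5) that by (simp add: successively_conv_nth)
  have hd: "ps ! 0 = u" and la: "ps ! (length ps - 1) = v"
    using ps by (auto simp: hd_conv_nth last_conv_nth)
  have "length ps \<noteq> 0" using ps by simp
  moreover have "length ps \<noteq> 1" using hd la \<open>u \<noteq> v\<close> by auto
  moreover have "length ps \<noteq> 2" using hd la suc[of 0] by auto
  ultimately have l: "3 \<le> length ps" by linarith
  have "{ps ! i, ps ! (Suc i mod length ps)} \<in> T" if "i < length ps" for i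
  proof (cases "Suc i < length ps")
    case True
    then show ?thesis using suc by auto
  next
    case False
    then have "Suc i = length ps" "i = length ps - 1" using that by simp_all
    then show ?thesis using hd la assms(2) by (simp add: insert_commute)
  qed
  then have "graph_cycle T ps" using ps l by (simp add: graph_cycle_def)
  then show False using assms(1) by blast
qed

section \<open>Counting components\<close>

text \<open>The values of \<open>c\<close> on \<open>V\<close> name the components. Edges are added
  one at a time; each merges at most one pair of components, and exactly one pair if it is a bridge.
  This gives the inequality in general and the equality for forests.\<close>

lemma component_labelling:
  assumes "finite V" "finite T" "\<forall>e\<in>T. \<exists>u\<in>V. \<exists>v\<in>V. u \<noteq> v \<and> e = {u, v}"
  shows "\<exists>c :: 'a \<Rightarrow> 'a. (\<forall>x y. c x = c y \<longleftrightarrow> (x, y) \<in> (adj T)\<^sup>*) \<and>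
    card V \<le> card (c ` V) + card T \<and>
    ((\<forall>u v. {u, v} \<in> T \<longrightarrow> u \<noteq> v \<longrightarrow> (u, v) \<notin> (adj (T - {{u, v}}))\<^sup>*) \<longrightarrow>
       card V = card (c ` V) + card T)"
  using assms(2,3)
proof (induction T)
  case empty
  have "adj ({} :: 'a set set) = {}" by (auto simp: adj_def)
  then show ?case by (intro exI[of _ id]) auto
next
  case (insert e T)
  obtain u v where uv: "u \<in> V" "v \<in> V" "u \<noteq> v" "e = {u, v}" using insert.prems by auto
  obtain c :: "'a \<Rightarrow> 'a" where c: "\<And>x y. c x = c y \<longleftrightarrow> (x, y) \<in> (adj T)\<^sup>*"
    and ge: "card V \<le> card (c ` V) + card T"
    and eq: "(\<forall>u v. {u, v} \<in> T \<longrightarrow> u \<noteq> v \<longrightarrow> (u, v) \<notin> (adj (T - {{u, v}}))\<^sup>*) \<longrightarrow>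
       card V = card (c ` V) + card T"
    using insert.IH insert.prems by blast
  \<comment> \<open>The component of \<open>v\<close> takes over the label of the component of
    \<open>u\<close>; nothing changes if the labels already agree.\<close>
  define c' where "c' x = (if c x = c v then c u else c x)" for x
  have inT: "(x, y) \<in> (adj T)\<^sup>* \<Longrightarrow> (x, y) \<in> (adj (insert e T))\<^sup>*" for x y
    by (rule adj_rtrancl_mono) auto
  have euv: "(u, v) \<in> (adj (insert e T))\<^sup>*" "(v, u) \<in> (adj (insert e T))\<^sup>*"
    using uv by (auto simp: insert_commute intro!: adj_rtrancl_edge)
  have lab: "c' x = c' y \<longleftrightarrow> (x, y) \<in> (adj (insert e T))\<^sup>*" for x y
  proof
    assume "c' x = c' y"
    then consider "c x = c y" | "c x = c v" "c u = c y" | "c x = c u" "c v = c y"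
      unfolding c'_def by (auto split: if_splits)
    then show "(x, y) \<in> (adj (insert e T))\<^sup>*"
    proof cases
      case 1
      then show ?thesis using c inT by blast
    next
      case 2
      then have "(x, v) \<in> (adj (insert e T))\<^sup>*" "(u, y) \<in> (adj (insert e T))\<^sup>*"
        using c inT by blast+
      then show ?thesis using euv(2) by (meson rtrancl_trans)
    next
      case 3
      then have "(x, u) \<in> (adj (insert e T))\<^sup>*" "(v, y) \<in> (adj (insert e T))\<^sup>*"
        using c inT by blast+
      then show ?thesis using euv(1) by (meson rtrancl_trans)
    qed
  next
    assume "(x, y) \<in> (adj (insert e T))\<^sup>*"
    moreover have "c' a = c' b" if "{a, b} \<in> insert e T" for a b
    proof (cases "{a, b} = e")
      case True
      then show ?thesis using uv by (auto simp: c'_def doubleton_eq_iff)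
    next
      case False
      then have "{a, b} \<in> T" using that by simp
      then have "c a = c b" unfolding c by (rule adj_rtrancl_edge)
      then show ?thesis by (simp add: c'_def)
    qed
    ultimately show "c' x = c' y" by (rule adj_rtrancl_invariant)
  qed
  have img: "c' ` V = (if c u = c v then c ` V else c ` V - {c v})"
    using uv by (auto simp: c'_def)
  have crd: "card (c ` V) = card (c' ` V) + (if c u = c v then 0 else 1)"
  proof (cases "c u = c v")
    case False
    have "c v \<in> c ` V" using uv by blast
    then have "card (c ` V) \<noteq> 0" using assms(1) by auto
    then show ?thesis using img False \<open>c v \<in> c ` V\<close> by simp
  qed (simp add: img)
  have ge': "card V \<le> card (c' ` V) + card (insert e T)"
    using ge crd insert.hyps by (auto split: if_splits)
  have eq': "card V = card (c' ` V) + card (insert e T)"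
    if fo: "\<forall>u v. {u, v} \<in> insert e T \<longrightarrow> u \<noteq> v \<longrightarrow> (u, v) \<notin> (adj (insert e T - {{u, v}}))\<^sup>*"
  proof -
    \<comment> \<open>A bridge of the larger edge set is a bridge of the smaller one, so the
      equality of the induction hypothesis applies.\<close>
    have "(a, b) \<notin> (adj (T - {{a, b}}))\<^sup>*" if "{a, b} \<in> T" "a \<noteq> b" for a b
    proof -
      have "(a, b) \<notin> (adj (insert e T - {{a, b}}))\<^sup>*" using fo that by blast
      moreover have "T - {{a, b}} \<subseteq> insert e T - {{a, b}}" by blast
      ultimately show ?thesis using adj_rtrancl_mono by metis
    qed
    then have "card V = card (c ` V) + card T" using eq by blast
    moreover have "c u \<noteq> c v"
    proof -
      have "(u, v) \<notin> (adj (insert e T - {e}))\<^sup>*" using fo uv by blast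
      then show ?thesis using c insert.hyps(2) by simp
    qed
    ultimately show ?thesis using crd insert.hyps by simp
  qed
  show ?case using lab ge' eq' by blast
qed

lemma simple_graph_finite: "simple_graph V E \<Longrightarrow> finite E"
proof -
  assume "simple_graph V E"
  then have "finite V" "E \<subseteq> Pow V" by (auto simp: simple_graph_def)
  then show "finite E" by (meson finite_Pow_iff finite_subset)
qed

lemma simple_graph_subset: "simple_graph V E \<Longrightarrow> T \<subseteq> E \<Longrightarrow> simple_graph V T"
  by (auto simp: simple_graph_def)

lemma card_image_labelling:
  assumes "graph_connected V T" "\<forall>x y. c x = c y \<longleftrightarrow> (x, y) \<in> (adj T)\<^sup>*"
  shows "card (c ` V) = 1"
proof -
  obtain r where "r \<in> V" using assms(1) by (auto simp: graph_connected_iff)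
  then have "c ` V = {c r}" using assms by (auto simp: graph_connected_iff)
  then show ?thesis by simp
qed

lemma graph_connected_card:
  assumes "simple_graph V T" "graph_connected V T"
  shows "card V \<le> Suc (card T)"
proof -
  have fin: "finite V" "\<forall>e\<in>T. \<exists>u\<in>V. \<exists>v\<in>V. u \<noteq> v \<and> e = {u, v}"
    using assms(1) by (simp_all add: simple_graph_def)
  obtain c :: "'a \<Rightarrow> 'a" where "\<forall>x y. c x = c y \<longleftrightarrow> (x, y) \<in> (adj T)\<^sup>*"
    "card V \<le> card (c ` V) + card T"
    using component_labelling[OF fin(1) simple_graph_finite[OF assms(1)] fin(2)]
    by (elim exE conjE) (rule that)
  then show ?thesis using card_image_labelling[OF assms(2), of c] by simp
qed

lemma graph_tree_card:
  assumes "graph_tree V T"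
  shows "card V = Suc (card T)"
proof -
  have sg: "simple_graph V T" and co: "graph_connected V T" and ac: "\<nexists>vs. graph_cycle T vs"
    using assms by (simp_all add: graph_tree_def)
  have br: "\<forall>u v. {u, v} \<in> T \<longrightarrow> u \<noteq> v \<longrightarrow> (u, v) \<notin> (adj (T - {{u, v}}))\<^sup>*"
    by (intro allI impI bridge_of_acyclic[OF ac])
  have fin: "finite V" "\<forall>e\<in>T. \<exists>u\<in>V. \<exists>v\<in>V. u \<noteq> v \<and> e = {u, v}"
    using sg by (simp_all add: simple_graph_def)
  obtain c :: "'a \<Rightarrow> 'a" where "\<forall>x y. c x = c y \<longleftrightarrow> (x, y) \<in> (adj T)\<^sup>*"
    "card V = card (c ` V) + card T"
    using component_labelling[OF fin(1) simple_graph_finite[OF sg] fin(2)]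
    by (elim exE conjE) (rule that, assumption, erule mp, rule br)
  then show ?thesis using card_image_labelling[OF co, of c] by simp
qed

lemma graph_treeI_minimal:
  assumes "simple_graph V T" "graph_connected V T" "\<And>e. e \<in> T \<Longrightarrow> \<not> graph_connected V (T - {e})"
  shows "graph_tree V T"
  unfolding graph_tree_def using assms(1,2) graph_cycle_remove_edge[OF assms(2)] assms(3) by blast

text \<open>Deleting an edge would leave too few edges to connect \<open>V\<close>, so the edge set
  is minimally connected.\<close>

lemma graph_treeI_card:
  assumes "simple_graph V T" "graph_connected V T" "card V = Suc (card T)"
  shows "graph_tree V T"
proof (rule graph_treeI_minimal[OF assms(1,2)])
  fix e assume e: "e \<in> T"
  have fin: "finite T" by (rule simple_graph_finite[OF assms(1)])
  show "\<not> graph_connected V (T - {e})"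
  proof
    assume "graph_connected V (T - {e})"
    then have "card V \<le> Suc (card (T - {e}))"
      using graph_connected_card simple_graph_subset[OF assms(1), of "T - {e}"] by blast
    then show False using assms(3) card_Diff1_less[OF fin e] by linarith
  qed
qed

lemma graph_tree_removal:
  assumes "graph_tree V T" "e \<in> T"
  shows "\<not> graph_connected V (T - {e})"
proof
  assume "graph_connected V (T - {e})"
  moreover have sg: "simple_graph V T" using assms(1) by (simp add: graph_tree_def)
  ultimately have "card V \<le> Suc (card (T - {e}))"
    using graph_connected_card simple_graph_subset[OF sg, of "T - {e}"] by blast
  then show False
    using graph_tree_card[OF assms(1)] card_Diff1_less[OF simple_graph_finite[OF sg] assms(2)] by linarith
qed

section \<open>Symmetric exchange and local maxima\<close>

lemma successively_leaves_set:
  assumes "successively P ps" "ps \<noteq> []" "hd ps \<in> U" "last ps \<notin> U"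
  shows "\<exists>as x y bs. ps = as @ x # y # bs \<and> x \<in> U \<and> y \<notin> U"
  using assms
proof (induction ps)
  case (Cons a ps)
  then obtain b qs where ps: "ps = b # qs" by (cases ps) auto
  show ?case
  proof (cases "b \<in> U")
    case True
    then obtain as x y bs where "ps = as @ x # y # bs" "x \<in> U" "y \<notin> U"
      using Cons ps by auto
    then show ?thesis by (metis append_Cons)
  next
    case False
    then show ?thesis using Cons ps by (intro exI[of _ "[]"]) auto
  qed
qed simp

text \<open>Without \<open>f\<close>, the tree \<open>T'\<close> falls into two sides, and the path
  in \<open>T\<close> between the ends of \<open>f\<close> crosses from one to the other along some
  \<open>e\<close>. That edge lies on the cycle that \<open>f\<close> closes in \<open>T\<close>,
  and it rejoins the two sides of \<open>T'\<close>, so one \<open>e\<close> serves both exchanges.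
  For \<open>T\<close> connectedness is enough to contradict local optimality; for \<open>T'\<close>
  the induction needs a tree.\<close>

lemma spanning_tree_exchange:
  assumes T: "graph_tree V T" and T': "graph_tree V T'" and f: "f \<in> T'" "f \<notin> T"
  obtains e where "e \<in> T" "e \<notin> T'" "graph_connected V (insert f T - {e})"
    "graph_tree V (insert e T' - {f})"
proof -
  have sg: "simple_graph V T" "simple_graph V T'" and con: "graph_connected V T" "graph_connected V T'"
    using T T' by (auto simp: graph_tree_def)
  obtain u v where uv: "u \<in> V" "v \<in> V" "u \<noteq> v" "f = {u, v}"
    using sg(2) f(1) by (auto simp: simple_graph_def)
  define U where "U = {x. (u, x) \<in> (adj (T' - {f}))\<^sup>*}"
  have T'f: "insert {u, v} (T' - {f}) = T'" using f uv by auto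
  have vU: "v \<notin> U"
  proof
    assume "v \<in> U"
    then have "graph_connected V (T' - {f})"
      using graph_connected_insert_imp[of V u v "T' - {f}" "T' - {f}"] con(2) T'f
      by (simp add: U_def)
    then show False using graph_tree_removal[OF T' f(1)] by simp
  qed
  have "(u, v) \<in> (adj T)\<^sup>*" using con uv by (auto simp: graph_connected_iff)
  then obtain ps where ps: "distinct ps" "ps \<noteq> []" "hd ps = u" "last ps = v"
    "successively (\<lambda>a b. {a, b} \<in> T) ps" by (rule adj_distinct_path)
  have "u \<in> U" by (simp add: U_def)
  then obtain as x y bs where split: "ps = as @ x # y # bs" and x: "x \<in> U" and y: "y \<notin> U"
    using successively_leaves_set[OF ps(5,2), of U] ps vU by auto
  define e where "e = {x, y}"
  have eT: "e \<in> T" using ps(5) by (auto simp: split successively_append_iff e_def)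
  have eT': "e \<notin> T'"
  proof
    assume "e \<in> T'"
    then have "{x, y} \<in> T' - {f}" using eT f by (auto simp: e_def)
    then show False using x y adj_rtrancl_step[of u x _ y] by (simp add: U_def)
  qed
  \<comment> \<open>The path is simple, so its part before \<open>e\<close> misses \<open>y\<close>
    and its part after \<open>e\<close> misses \<open>x\<close>; neither part uses
    \<open>e\<close>.\<close>
  have ux: "(u, x) \<in> (adj (T - {e}))\<^sup>*"
  proof -
    have "(hd (as @ [x]), last (as @ [x])) \<in> (adj (T - {e}))\<^sup>*"
      by (rule adj_path_avoiding[of _ _ y])
        (use ps(1,5) in \<open>auto simp: split successively_append_iff e_def\<close>)
    moreover have "hd (as @ [x]) = u" using ps(3) split by (cases as) auto
    ultimately show ?thesis by simp
  qed
  have yv: "(y, v) \<in> (adj (T - {e}))\<^sup>*"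
  proof -
    have "(hd (y # bs), last (y # bs)) \<in> (adj (T - {e}))\<^sup>*"
      by (rule adj_path_avoiding[of _ _ x])
        (use ps(1,5) in \<open>auto simp: split successively_append_iff successively_Cons e_def\<close>)
    then show ?thesis using ps(4) split by simp
  qed
  have con1: "graph_connected V (insert f T - {e})"
  proof (rule graph_connected_insert_imp[of V x y "T - {e}"])
    show "graph_connected V (insert {x, y} (T - {e}))"
      using con(1) eT by (simp add: e_def[symmetric] insert_absorb)
    show sub: "T - {e} \<subseteq> insert f T - {e}" by blast
    have "(u, v) \<in> (adj (insert f T - {e}))\<^sup>*" using uv f eT by (intro adj_rtrancl_edge) auto
    then show "(x, y) \<in> (adj (insert f T - {e}))\<^sup>*"
      using adj_rtrancl_mono[OF sub sym_adj_rtrancl[OF ux]]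
        adj_rtrancl_mono[OF sub sym_adj_rtrancl[OF yv]]
      by (meson rtrancl_trans)
  qed
  \<comment> \<open>Once \<open>f\<close> is gone, every vertex reachable from \<open>v\<close> in
    \<open>T'\<close> lies on the side of \<open>u\<close> or on that of \<open>v\<close>, and
    \<open>y\<close> is not on the side of \<open>u\<close>.\<close>
  have yv': "(y, v) \<in> (adj (T' - {f}))\<^sup>*"
  proof -
    have "y \<in> V" using sg(1) eT by (auto simp: e_def simple_graph_def doubleton_eq_iff)
    then have "(v, y) \<in> (adj T')\<^sup>*" using con(2) uv by (auto simp: graph_connected_iff)
    moreover have "z \<in> U \<or> (v, z) \<in> (adj (T' - {f}))\<^sup>*" if "(v, z) \<in> (adj T')\<^sup>*" for z
      using that
    proof induction
      case (step z w)
      show ?case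
      proof (cases "{z, w} = f")
        case True
        then have "w = u \<or> w = v" using uv by (auto simp: doubleton_eq_iff)
        then show ?thesis by (auto simp: U_def)
      next
        case False
        then have "{z, w} \<in> T' - {f}" using step(2) by simp
        then show ?thesis using step(3) adj_rtrancl_step[of _ z _ w] unfolding U_def by blast
      qed
    qed simp
    ultimately have "(v, y) \<in> (adj (T' - {f}))\<^sup>*" using y by blast
    then show ?thesis by (rule sym_adj_rtrancl)
  qed
  have con2: "graph_connected V (insert e T' - {f})"
  proof (rule graph_connected_insert_imp[of V u v "T' - {f}"])
    show "graph_connected V (insert {u, v} (T' - {f}))" using con(2) T'f by simp
    show sub: "T' - {f} \<subseteq> insert e T' - {f}" by blast
    have "(x, y) \<in> (adj (insert e T' - {f}))\<^sup>*"
      using f eT by (intro adj_rtrancl_edge) (auto simp: e_def)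
    moreover have "(u, x) \<in> (adj (insert e T' - {f}))\<^sup>*" using adj_rtrancl_mono[OF sub] x by (simp add: U_def)
    ultimately show "(u, v) \<in> (adj (insert e T' - {f}))\<^sup>*"
      using adj_rtrancl_mono[OF sub yv'] by (meson rtrancl_trans)
  qed
  have "graph_tree V (insert e T' - {f})"
  proof (rule graph_treeI_card)
    show "simple_graph V (insert e T' - {f})" using sg eT by (auto simp: simple_graph_def)
    show "graph_connected V (insert e T' - {f})" by (rule con2)
    have "finite T'" by (rule simple_graph_finite[OF sg(2)])
    moreover have "card T' \<noteq> 0" using \<open>finite T'\<close> f by auto
    ultimately show "card V = Suc (card (insert e T' - {f}))"
      using graph_tree_card[OF T'] f eT' by auto
  qed
  then show ?thesis using that eT eT' con1 by blast
qed

text \<open>An edge \<open>f\<close> of \<open>T'\<close> in \<open>L\<close> but outside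
  \<open>T\<close> is exchanged for an edge \<open>e\<close> of \<open>T\<close>. Local maximality
  forces \<open>e\<close> into \<open>L\<close>, so \<open>T'\<close> keeps its number of edges in
  \<open>L\<close> while \<open>card (T' - T)\<close> drops.\<close>

lemma spanning_tree_local_max:
  assumes T: "graph_tree V T" and T': "graph_tree V T'"
    and loc: "\<And>e f. e \<in> T \<Longrightarrow> e \<notin> L \<Longrightarrow> f \<in> L \<Longrightarrow> \<not> graph_connected V (insert f T - {e})"
  shows "card (T' \<inter> L) \<le> card (T \<inter> L)"
proof -
  have finT: "finite T" using T simple_graph_finite by (auto simp: graph_tree_def)
  show ?thesis using T'
  proof (induction "card (T' - T)" arbitrary: T' rule: less_induct)
    case less
    have finT': "finite T'" using less.prems simple_graph_finite by (auto simp: graph_tree_def)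
    show ?case
    proof (cases "\<exists>f. f \<in> T' \<and> f \<notin> T \<and> f \<in> L")
      case False
      then show ?thesis using finT by (intro card_mono) auto
    next
      case True
      then obtain f where f: "f \<in> T'" "f \<notin> T" "f \<in> L" by blast
      obtain e where e: "e \<in> T" "e \<notin> T'" "graph_connected V (insert f T - {e})"
        "graph_tree V (insert e T' - {f})"
        using spanning_tree_exchange[OF T less.prems f(1,2)] .
      have eL: "e \<in> L" using loc[of e f] e f by blast
      define T2 where "T2 = insert e T' - {f}"
      have "T2 - T = (T' - T) - {f}" using e by (auto simp: T2_def)
      then have lt: "card (T2 - T) < card (T' - T)"
        using f finT' card_Diff1_less[of "T' - T" f] by (simp del: card_Diff_singleton)
      have "card (T2 \<inter> L) \<le> card (T \<inter> L)"
        by (rule less.hyps[OF lt]) (use e in \<open>simp add: T2_def\<close>)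
      moreover have "card (T2 \<inter> L) = card (T' \<inter> L)"
      proof -
        have "T2 \<inter> L = insert e (T' \<inter> L - {f})" using f e(1,2) eL by (auto simp: T2_def)
        then show ?thesis using card.insert_remove[of "T' \<inter> L - {f}" e] card_Suc_Diff1[of "T' \<inter> L" f] finT' e(2) f
          by (simp del: card_Diff_insert)
      qed
      ultimately show ?thesis by simp
    qed
  qed
qed

section \<open>Locally optimal families of spanning trees\<close>

text \<open>\<open>arg_max\<close> is a choice operator, so its properties depend on the existence
  of a maximiser. One exists because \<open>E\<close> has finitely many subsets and
  \<open>T0\<close> is a spanning tree.\<close>

lemma max_spanning_tree_is_max:
  assumes "finite E" "spanning_tree_of V E T0"
  shows "spanning_tree_of V E (max_spanning_tree V E \<omega>)"
    and "spanning_tree_of V E T \<Longrightarrow> sum \<omega> T \<le> sum \<omega> (max_spanning_tree V E \<omega>)"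
proof -
  let ?S = "{T. spanning_tree_of V E T}"
  have "?S \<subseteq> Pow E" by (auto simp: spanning_tree_of_def)
  then have fin: "finite ?S" using assms(1) by (meson finite_Pow_iff finite_subset)
  then have "Max (sum \<omega> ` ?S) \<in> sum \<omega> ` ?S" using assms(2) by (intro Max_in) auto
  then obtain T1 where T1: "spanning_tree_of V E T1" "sum \<omega> T1 = Max (sum \<omega> ` ?S)" by auto
  have "is_arg_max (sum \<omega>) (spanning_tree_of V E) T1"
    unfolding is_arg_max_def T1(2) using T1(1) fin by (auto simp: not_less)
  then have "is_arg_max (sum \<omega>) (spanning_tree_of V E) (max_spanning_tree V E \<omega>)"
    unfolding max_spanning_tree_def arg_max_def by (rule someI)
  then show "spanning_tree_of V E (max_spanning_tree V E \<omega>)"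
    and "spanning_tree_of V E T \<Longrightarrow> sum \<omega> T \<le> sum \<omega> (max_spanning_tree V E \<omega>)"
    by (auto simp: is_arg_max_def not_less)
qed

section \<open>Families of edge sets, loads and load gaps\<close>

definition load :: "nat \<Rightarrow> (nat \<Rightarrow> 'a set set) \<Rightarrow> 'a set \<Rightarrow> nat" where
  "load K Tr e = card {i. i < K \<and> e \<in> Tr i}"

text \<open>The case \<open>f = e\<close> says that no edge can be deleted, which makes the
  connected members spanning trees. A load difference of at least 2 is the range in which a swap
  lowers the sum of squared loads.\<close>

definition locally_optimal :: "'a set \<Rightarrow> 'a set set \<Rightarrow> nat \<Rightarrow> (nat \<Rightarrow> 'a set set) \<Rightarrow> bool" where
  "locally_optimal V E K Tr \<longleftrightarrow>
     (\<forall>i<K. Tr i \<subseteq> E \<and> graph_connected V (Tr i)) \<and>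
     (\<forall>i<K. \<forall>e\<in>Tr i. \<forall>f\<in>E. f = e \<or> load K Tr f + 2 \<le> load K Tr e \<longrightarrow>
        \<not> graph_connected V (insert f (Tr i) - {e}))"

text \<open>Edges outside the level set of load at most \<open>j\<close> have load at least
  \<open>j + 2\<close>, so every swap of such an edge for one inside satisfies the load condition of
  a move. The last conjunct keeps \<open>j\<close> within \<open>card E - 1\<close> of the minimum
  load.\<close>

definition load_gap :: "'a set set \<Rightarrow> ('a set \<Rightarrow> nat) \<Rightarrow> nat \<Rightarrow> bool" where
  "load_gap E ld j \<longleftrightarrow>
     (\<exists>e\<in>E. ld e \<le> j) \<and> (\<forall>e\<in>E. ld e \<noteq> Suc j) \<and> (\<forall>e\<in>E. j < ld e + card E)"

definition indicator_weight :: "'a set set \<Rightarrow> 'a set \<Rightarrow> real" where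
  "indicator_weight F e = (if e \<in> F then 1 else 0)"

lemma sum_indicator_weight: "finite A \<Longrightarrow> sum (indicator_weight F) A = real (card (A \<inter> F))"
  by (simp add: indicator_weight_def sum.If_cases)

text \<open>Double counting of the pairs \<open>(i, e)\<close> with \<open>e\<close> in
  \<open>Tr i\<close> and in \<open>F\<close>. It is used with arbitrary weights on \<open>E\<close>
  and with weight 1 on a level set.\<close>

lemma sum_over_family:
  fixes \<omega> :: "'a set \<Rightarrow> 'b :: comm_semiring_1"
  assumes "finite E" "\<And>i. i < K \<Longrightarrow> Tr i \<subseteq> E" "F \<subseteq> E"
  shows "(\<Sum>i<K. sum \<omega> (Tr i \<inter> F)) = (\<Sum>e\<in>F. of_nat (load K Tr e) * \<omega> e)"
proof -
  have finF: "finite F" using assms(1,3) finite_subset by blast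
  have "sum \<omega> (Tr i \<inter> F) = (\<Sum>e\<in>F. if e \<in> Tr i then \<omega> e else 0)" for i
    using finF by (simp add: sum.If_cases Int_commute)
  then have "(\<Sum>i<K. sum \<omega> (Tr i \<inter> F)) = (\<Sum>e\<in>F. \<Sum>i<K. if e \<in> Tr i then \<omega> e else 0)"
    using sum.swap by simp
  also have "\<dots> = (\<Sum>e\<in>F. of_nat (load K Tr e) * \<omega> e)"
  proof (rule sum.cong)
    fix e
    have "{..<K} \<inter> {i. e \<in> Tr i} = {i. i < K \<and> e \<in> Tr i}" by auto
    then show "(\<Sum>i<K. if e \<in> Tr i then \<omega> e else 0) = of_nat (load K Tr e) * \<omega> e"
      by (simp add: sum.If_cases load_def)
  qed simp
  finally show ?thesis .
qed

section \<open>Ratio bounds from a locally optimal family\<close>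

locale connected_graph =
  fixes V :: "'a set" and E :: "'a set set"
  assumes simple: "simple_graph V E" and connected: "graph_connected V E" and nonempty: "E \<noteq> {}"
begin

lemma finite_E: "finite E"
  by (rule simple_graph_finite[OF simple])

lemma card_E_pos: "0 < card E"
  using finite_E nonempty by (simp add: card_gt_0_iff)

lemma weightings_sum_pos: "\<omega> \<in> weightings E \<Longrightarrow> 0 < sum \<omega> E"
proof -
  assume "\<omega> \<in> weightings E"
  then obtain e where "e \<in> E" "\<omega> e \<noteq> 0" and nn: "\<forall>e\<in>E. 0 \<le> \<omega> e" by (auto simp: weightings_def)
  then show ?thesis using finite_E by (intro sum_pos2[of E e]) (auto simp: order.strict_iff_order)
qed

lemma locally_optimal_spanning_tree:
  assumes "locally_optimal V E K Tr" "i < K"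
  shows "spanning_tree_of V E (Tr i)"
proof -
  have sub: "Tr i \<subseteq> E" and con: "graph_connected V (Tr i)"
    using assms by (auto simp: locally_optimal_def)
  have "\<not> graph_connected V (Tr i - {e})" if "e \<in> Tr i" for e
  proof -
    have "\<not> graph_connected V (insert e (Tr i) - {e})"
      using assms that sub unfolding locally_optimal_def by blast
    then show ?thesis using that by (simp add: insert_absorb)
  qed
  then have "graph_tree V (Tr i)"
    using graph_treeI_minimal[OF simple_graph_subset[OF simple sub] con] by blast
  then show ?thesis using sub by (simp add: spanning_tree_of_def)
qed

text \<open>Averaging: together the members weigh at least \<open>l\<close> times the whole graph,
  and none outweighs the maximum spanning tree.\<close>

lemma weighting_ratio_lower_bound:
  assumes lo: "locally_optimal V E K Tr" and K: "0 < K" and l: "\<And>e. e \<in> E \<Longrightarrow> l \<le> load K Tr e"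
    and w: "\<omega> \<in> weightings E"
  shows "real l / real K \<le> weighting_ratio V E \<omega>"
proof -
  note st = locally_optimal_spanning_tree[OF lo]
  let ?M = "sum \<omega> (max_spanning_tree V E \<omega>)"
  have sub: "\<And>i. i < K \<Longrightarrow> Tr i \<subseteq> E" using lo by (simp add: locally_optimal_def)
  have nn: "\<And>e. e \<in> E \<Longrightarrow> 0 \<le> \<omega> e" using w by (simp add: weightings_def)
  have "real l * sum \<omega> E = (\<Sum>e\<in>E. real l * \<omega> e)" by (simp add: sum_distrib_left)
  also have "\<dots> \<le> (\<Sum>e\<in>E. real (load K Tr e) * \<omega> e)"
    using l nn by (intro sum_mono mult_right_mono) auto
  also have "\<dots> = (\<Sum>i<K. sum \<omega> (Tr i \<inter> E))"
    using sum_over_family[OF finite_E sub subset_refl, where \<omega> = \<omega>] by simp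
  also have "\<dots> \<le> (\<Sum>i<K. ?M)"
  proof (rule sum_mono)
    fix i assume "i \<in> {..<K}"
    then have i: "i < K" by simp
    have "Tr i \<inter> E = Tr i" using sub[OF i] by blast
    then show "sum \<omega> (Tr i \<inter> E) \<le> ?M"
      using max_spanning_tree_is_max(2)[OF finite_E st[OF i] st[OF i], of \<omega>] by simp
  qed
  finally have "real l * sum \<omega> E \<le> real K * ?M" by simp
  then show ?thesis using K weightings_sum_pos[OF w] unfolding weighting_ratio_def
    by (simp add: field_simps)
qed

lemma indicator_weight_weighting:
  "F \<subseteq> E \<Longrightarrow> F \<noteq> {} \<Longrightarrow> indicator_weight F \<in> weightings E"
  by (auto simp: weightings_def indicator_weight_def)

lemma sum_indicator_weight_E: "F \<subseteq> E \<Longrightarrow> sum (indicator_weight F) E = real (card F)"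
  using finite_E by (simp add: sum_indicator_weight Int_absorb1)

text \<open>Every member is a maximum spanning tree for the indicator of \<open>L\<close>: the gap
  turns a swap of an edge outside \<open>L\<close> for one inside into a load difference of at least
  2, which local optimality excludes.\<close>

lemma indicator_weight_ratio:
  assumes lo: "locally_optimal V E K Tr" and gap: "load_gap E (load K Tr) j" and i: "i < K"
    and L: "L = {e \<in> E. load K Tr e \<le> j}"
  shows "weighting_ratio V E (indicator_weight L) = real (card (Tr i \<inter> L)) / real (card L)"
proof -
  have st: "spanning_tree_of V E (Tr i)" by (rule locally_optimal_spanning_tree[OF lo i])
  let ?M = "max_spanning_tree V E (indicator_weight L)"
  have M: "spanning_tree_of V E ?M" by (rule max_spanning_tree_is_max(1)[OF finite_E st])
  have fin: "finite (Tr i)" "finite ?M" using st M finite_E finite_subset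
    unfolding spanning_tree_of_def by blast+
  have "card (?M \<inter> L) \<le> card (Tr i \<inter> L)"
  proof (rule spanning_tree_local_max[of V])
    show "graph_tree V (Tr i)" "graph_tree V ?M" using st M by (simp_all add: spanning_tree_of_def)
    fix e f assume e: "e \<in> Tr i" "e \<notin> L" and f: "f \<in> L"
    have eE: "e \<in> E" and fE: "f \<in> E" using e st f by (auto simp: spanning_tree_of_def L)
    then have "j < load K Tr e" "load K Tr e \<noteq> Suc j" "load K Tr f \<le> j"
      using e f gap by (auto simp: L load_gap_def)
    then have "load K Tr f + 2 \<le> load K Tr e" by linarith
    then show "\<not> graph_connected V (insert f (Tr i) - {e})"
      using lo i e fE by (auto simp: locally_optimal_def)
  qed
  moreover have "card (Tr i \<inter> L) \<le> card (?M \<inter> L)"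
    using max_spanning_tree_is_max(2)[OF finite_E st st, of "indicator_weight L"] fin
    by (simp add: sum_indicator_weight)
  ultimately show ?thesis
    using fin sum_indicator_weight_E[of L] by (simp add: weighting_ratio_def sum_indicator_weight L)
qed

text \<open>All members meet \<open>L\<close> equally often, and the number of incidences in total
  is the sum of the loads on \<open>L\<close>, each at most \<open>j\<close>.\<close>

lemma indicator_weight_ratio_le:
  assumes lo: "locally_optimal V E K Tr" and gap: "load_gap E (load K Tr) j" and K: "0 < K"
    and L: "L = {e \<in> E. load K Tr e \<le> j}"
  shows "weighting_ratio V E (indicator_weight L) \<le> real j / real K"
proof -
  let ?r = "weighting_ratio V E (indicator_weight L)"
  have LE: "L \<subseteq> E" "L \<noteq> {}" using gap by (auto simp: L load_gap_def)
  then have cL: "0 < card L" using finite_E finite_subset by (auto simp: card_gt_0_iff)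
  have sub: "\<And>i. i < K \<Longrightarrow> Tr i \<subseteq> E" using lo by (simp add: locally_optimal_def)
  have "real K * (?r * real (card L)) = (\<Sum>i<K. ?r * real (card L))" by simp
  also have "\<dots> = (\<Sum>i<K. sum (\<lambda>_. 1 :: real) (Tr i \<inter> L))"
    using indicator_weight_ratio[OF lo gap _ L] cL by (intro sum.cong) auto
  also have "\<dots> = (\<Sum>e\<in>L. real (load K Tr e))"
    using sum_over_family[OF finite_E sub LE(1), where \<omega> = "\<lambda>_. 1 :: real"] by simp
  also have "\<dots> \<le> (\<Sum>e\<in>L. real j)" by (rule sum_mono) (simp add: L)
  also have "\<dots> = real j * real (card L)" by simp
  finally have "(real K * ?r) * real (card L) \<le> real j * real (card L)" by (simp only: mult.assoc)
  then have "real K * ?r \<le> real j" using cL by (simp only: mult_le_cancel_right)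
  then show ?thesis using K by (simp add: field_simps)
qed

section \<open>The sum of squared loads as a potential\<close>

lemma move_decreases_load_squares:
  fixes ld :: "'a set \<Rightarrow> nat"
  assumes "e \<in> E" "f \<in> E" "e \<noteq> f" "ld f + 2 \<le> ld e"
  shows "(\<Sum>g\<in>E. ((ld(e := ld e - 1, f := ld f + 1)) g)\<^sup>2) < (\<Sum>g\<in>E. (ld g)\<^sup>2)"
proof -
  let ?ld = "ld(e := ld e - 1, f := ld f + 1)"
  have split: "sum h E = h e + h f + sum h (E - {e} - {f})" for h :: "'a set \<Rightarrow> nat"
    using assms finite_E by (simp add: sum.remove[of E e] sum.remove[of "E - {e}" f])
  have "sum (\<lambda>g. (?ld g)\<^sup>2) (E - {e} - {f}) = sum (\<lambda>g. (ld g)\<^sup>2) (E - {e} - {f})"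
    by (rule sum.cong) auto
  \<comment> \<open>Writing the load of \<open>e\<close> through \<open>d\<close> removes the
    truncated subtraction; the squares drop by \<open>2 * d + 2\<close>.\<close>
  moreover obtain d where "ld e = ld f + 2 + d" using assms(4) le_Suc_ex by blast
  then have "(ld e - 1)\<^sup>2 + (ld f + 1)\<^sup>2 < (ld e)\<^sup>2 + (ld f)\<^sup>2"
    by (simp add: power2_eq_square algebra_simps)
  ultimately show ?thesis using assms(3) by (simp add: split)
qed

lemma removal_decreases_load_squares:
  fixes ld :: "'a set \<Rightarrow> nat"
  assumes "e \<in> E" "0 < ld e"
  shows "(\<Sum>g\<in>E. ((ld(e := ld e - 1)) g)\<^sup>2) < (\<Sum>g\<in>E. (ld g)\<^sup>2)"
proof (rule sum_strict_mono_ex1[OF finite_E])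
  have "(ld e - 1)\<^sup>2 < (ld e)\<^sup>2" using assms(2) by (intro power_strict_mono) auto
  then show "\<exists>g\<in>E. ((ld(e := ld e - 1)) g)\<^sup>2 < (ld g)\<^sup>2" using assms(1) by auto
qed (auto intro: power_mono)

lemma load_pos: "i < K \<Longrightarrow> e \<in> Tr i \<Longrightarrow> 0 < load K Tr e"
  by (auto simp: load_def card_gt_0_iff)

text \<open>Inserting an \<open>f\<close> that is already present, in particular
  \<open>f = e\<close>, changes nothing, so such a move is a pure deletion.\<close>

lemma load_after_move:
  assumes "i < K" "e \<in> Tr i"
  shows "load K (Tr(i := insert f (Tr i) - {e})) =
    (if f \<in> Tr i then (load K Tr)(e := load K Tr e - 1)
     else (load K Tr)(e := load K Tr e - 1, f := load K Tr f + 1))"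
proof
  fix g
  let ?Tr = "Tr(i := insert f (Tr i) - {e})"
  have rest: "{k. k < K \<and> g \<in> ?Tr k} =
    (if g \<noteq> e \<and> (g = f \<or> g \<in> Tr i) then insert i {k. k < K \<and> k \<noteq> i \<and> g \<in> Tr k}
     else {k. k < K \<and> k \<noteq> i \<and> g \<in> Tr k})"
    using assms(1) by auto
  have old: "{k. k < K \<and> g \<in> Tr k} =
    (if g \<in> Tr i then insert i {k. k < K \<and> k \<noteq> i \<and> g \<in> Tr k}
     else {k. k < K \<and> k \<noteq> i \<and> g \<in> Tr k})"
    using assms(1) by auto
  show "load K ?Tr g =
    (if f \<in> Tr i then (load K Tr)(e := load K Tr e - 1)
     else (load K Tr)(e := load K Tr e - 1, f := load K Tr f + 1)) g"
    unfolding load_def rest using assms old by (cases "g = e"; cases "g = f") auto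
qed

lemma move_decreases_potential:
  assumes "i < K" "e \<in> Tr i" "e \<in> E" "f \<in> E" "f = e \<or> load K Tr f + 2 \<le> load K Tr e"
  shows "(\<Sum>g\<in>E. (load K (Tr(i := insert f (Tr i) - {e})) g)\<^sup>2) < (\<Sum>g\<in>E. (load K Tr g)\<^sup>2)"
proof (cases "f \<in> Tr i")
  case True
  then show ?thesis
    using removal_decreases_load_squares[OF assms(3), of "load K Tr"] load_pos[where Tr = Tr, OF assms(1,2)]
      load_after_move[where Tr = Tr, OF assms(1,2), of f] by simp
next
  case False
  then have "e \<noteq> f" using assms(2) by auto
  then show ?thesis
    using move_decreases_load_squares[OF assms(3,4), of "load K Tr"] assms(5)
      load_after_move[where Tr = Tr, OF assms(1,2), of f] False by simp
qed

text \<open>A family of minimal potential admits no move. This holds for every \<open>K\<close>, as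
  the limit argument in \<open>best_indicator\<close> requires.\<close>

lemma locally_optimal_exists: "\<exists>Tr. locally_optimal V E K Tr"
proof -
  define P where "P Tr \<longleftrightarrow> (\<forall>i<K. Tr i \<subseteq> E \<and> graph_connected V (Tr i))" for Tr
  define m where "m Tr = (\<Sum>g\<in>E. (load K Tr g)\<^sup>2)" for Tr
  have "P (\<lambda>_. E)" using connected by (simp add: P_def)
  then obtain Tr where Tr: "P Tr" and least: "\<And>Tr'. P Tr' \<Longrightarrow> m Tr \<le> m Tr'"
    using ex_has_least_nat[of P _ m] by blast
  have "locally_optimal V E K Tr"
    unfolding locally_optimal_def
  proof (intro conjI allI impI ballI notI)
    fix i e f assume i: "i < K" and e: "e \<in> Tr i" and f: "f \<in> E"
      and imp: "f = e \<or> load K Tr f + 2 \<le> load K Tr e"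
      and con: "graph_connected V (insert f (Tr i) - {e})"
    have "e \<in> E" using Tr i e by (auto simp: P_def)
    then have "m (Tr(i := insert f (Tr i) - {e})) < m Tr"
      unfolding m_def using move_decreases_potential[of i K e Tr f] i e f imp by blast
    moreover have "P (Tr(i := insert f (Tr i) - {e}))" using Tr con f by (auto simp: P_def)
    ultimately show False using least by (meson not_less)
  qed (use Tr in \<open>auto simp: P_def\<close>)
  then show ?thesis by blast
qed

section \<open>Gaps in the sequence of loads\<close>

lemma min_load_exists:
  fixes ld :: "'a set \<Rightarrow> nat"
  shows "\<exists>e\<in>E. \<forall>g\<in>E. ld e \<le> ld g"
  using ex_min_if_finite[of "ld ` E"] finite_E nonempty by (fastforce simp: not_less)

text \<open>Pigeonhole: different loads need different edges.\<close>

lemma consecutive_loads_bound: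
  fixes ld :: "'a set \<Rightarrow> nat"
  assumes "\<And>x. l \<le> x \<Longrightarrow> x \<le> j \<Longrightarrow> \<exists>e\<in>E. ld e = x"
  shows "j < l + card E"
proof -
  have "{l..j} \<subseteq> ld ` E" using assms by (fastforce simp: image_iff)
  then have "card {l..j} \<le> card E" using finite_E card_image_le card_mono
    by (metis finite_imageI le_trans)
  then show ?thesis using card_E_pos by simp
qed

text \<open>Take the least level, from the minimum load on, whose successor is empty. All levels up
  to it are occupied, which bounds it.\<close>

lemma load_gap_exists:
  fixes ld :: "'a set \<Rightarrow> nat"
  shows "\<exists>j. load_gap E ld j"
proof -
  obtain e0 where e0: "e0 \<in> E" "\<And>g. g \<in> E \<Longrightarrow> ld e0 \<le> ld g"
    using min_load_exists[of ld] by blast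
  define Q where "Q j \<longleftrightarrow> ld e0 \<le> j \<and> (\<forall>e\<in>E. ld e \<noteq> Suc j)" for j
  have "\<exists>j. Q j"
  proof (rule ccontr)
    assume "\<nexists>j. Q j"
    then have "\<exists>e\<in>E. ld e = x" if "ld e0 \<le> x" for x
      using that e0(1) by (cases "x = ld e0"; cases x) (auto simp: Q_def)
    \<comment> \<open>If all levels from the minimum on were occupied, the pigeonhole bound would
      hold even at level \<open>ld e0 + card E\<close>.\<close>
    then have "ld e0 + card E < ld e0 + card E" by (rule consecutive_loads_bound) auto
    then show False by simp
  qed
  then have Q: "Q (LEAST j. Q j)" by (meson LeastI)
  define j where "j = (LEAST j. Q j)"
  have "j < ld e0 + card E"
  proof (rule consecutive_loads_bound)
    fix x assume x: "ld e0 \<le> x" "x \<le> j"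
    show "\<exists>e\<in>E. ld e = x"
    proof (cases "x = ld e0")
      case False
      then obtain y where y: "x = Suc y" "ld e0 \<le> y" using x by (cases x) auto
      then have "\<not> Q y" using x not_less_Least[of y Q] by (simp add: j_def)
      then show ?thesis using y by (auto simp: Q_def)
    qed (use e0 in blast)
  qed
  moreover have "j < ld g + card E" if "g \<in> E" for g
    using e0(2)[OF that] calculation by linarith
  moreover have "ld e0 \<le> j" "\<forall>e\<in>E. ld e \<noteq> Suc j" using Q by (simp_all add: Q_def j_def)
  ultimately have "load_gap E ld j" using e0(1) unfolding load_gap_def by blast
  then show ?thesis by blast
qed

text \<open>With \<open>l\<close> the minimum load, the upper bound \<open>j / K\<close> for the
  indicator and the lower bound \<open>l / K\<close> for \<open>\<omega>\<close> are at most
  \<open>(card E - 1) / K\<close> apart.\<close>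

lemma load_gap_ratio_le:
  assumes lo: "locally_optimal V E K Tr" and gap: "load_gap E (load K Tr) j" and K: "0 < K"
    and L: "L = {e \<in> E. load K Tr e \<le> j}" and w: "\<omega> \<in> weightings E"
  shows "weighting_ratio V E (indicator_weight L) \<le> weighting_ratio V E \<omega> + (real (card E) - 1) / real K"
proof -
  obtain e where e: "e \<in> E" "\<And>g. g \<in> E \<Longrightarrow> load K Tr e \<le> load K Tr g"
    using min_load_exists[of "load K Tr"] by blast
  have "Suc j \<le> load K Tr e + card E" using gap e(1) by (auto simp: load_gap_def)
  then have "real j \<le> real (load K Tr e) + (real (card E) - 1)" by linarith
  then have "real j / real K \<le> real (load K Tr e) / real K + (real (card E) - 1) / real K"
    using K by (simp add: divide_right_mono flip: add_divide_distrib)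
  then show ?thesis
    using indicator_weight_ratio_le[OF lo gap K L] weighting_ratio_lower_bound[OF lo K e(2) w] by linarith
qed

section \<open>Exact optimality of a level set\<close>

text \<open>There are finitely many indicators, so one is best among them. As \<open>K\<close>
  grows, level sets exceed the ratio of a given weighting by arbitrarily little, hence the best
  indicator beats every weighting and the infimum is attained.\<close>

lemma best_indicator:
  obtains F where "F \<subseteq> E" "F \<noteq> {}"
    "\<And>\<omega>. \<omega> \<in> weightings E \<Longrightarrow> weighting_ratio V E (indicator_weight F) \<le> weighting_ratio V E \<omega>"
proof -
  let ?S = "{F. F \<subseteq> E \<and> F \<noteq> {}}" and ?r = "\<lambda>F. weighting_ratio V E (indicator_weight F)"
  have fin: "finite ?S" using finite_E by simp
  have "E \<in> ?S" using nonempty by simp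
  then have ne: "?r ` ?S \<noteq> {}" by blast
  have "Min (?r ` ?S) \<in> ?r ` ?S" using fin ne by (intro Min_in) auto
  then obtain F where F: "F \<in> ?S" "?r F = Min (?r ` ?S)"
    by (metis (no_types, lifting) imageE)
  have best: "?r F \<le> ?r L" if "L \<in> ?S" for L unfolding F(2) using fin that by simp
  have "?r F \<le> weighting_ratio V E \<omega>" if w: "\<omega> \<in> weightings E" for \<omega>
  proof (rule field_le_epsilon)
    fix \<epsilon> :: real assume "0 < \<epsilon>"
    \<comment> \<open>Chosen so that the error \<open>(card E - 1) / K\<close> of a level set is at
      most \<open>\<epsilon>\<close>.\<close>
    obtain k where k: "(real (card E) - 1) / \<epsilon> < real k" using reals_Archimedean2 by blast
    define K where "K = Suc k"
    have K: "(real (card E) - 1) / \<epsilon> < real K" "0 < K" using k by (simp_all add: K_def)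
    obtain Tr where lo: "locally_optimal V E K Tr" using locally_optimal_exists by blast
    obtain j where gap: "load_gap E (load K Tr) j" using load_gap_exists by blast
    let ?L = "{e \<in> E. load K Tr e \<le> j}"
    have "?L \<in> ?S" using gap by (auto simp: load_gap_def)
    then have "?r F \<le> ?r ?L" by (rule best)
    also have "\<dots> \<le> weighting_ratio V E \<omega> + (real (card E) - 1) / real K"
      by (rule load_gap_ratio_le[OF lo gap K(2) refl w])
    also have "(real (card E) - 1) / real K \<le> \<epsilon>" using K \<open>0 < \<epsilon>\<close> by (simp add: field_simps)
    finally show "?r F \<le> weighting_ratio V E \<omega> + \<epsilon>" by simp
  qed
  moreover have "F \<subseteq> E" "F \<noteq> {}" using F(1) by auto
  ultimately show ?thesis using that by blast
qed

text \<open>The point is the denominator, at most \<open>card E\<close>, which makes the competing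
  ratios discrete. The family with \<open>K = 1\<close> supplies a spanning tree, so that
  \<open>max_spanning_tree\<close> really denotes one.\<close>

lemma indicator_weight_ratio_fraction:
  assumes "F \<subseteq> E"
  shows "\<exists>p :: nat. weighting_ratio V E (indicator_weight F) = real p / real (card F)"
proof -
  obtain Tr where "locally_optimal V E 1 Tr" using locally_optimal_exists by blast
  then have "spanning_tree_of V E (Tr 0)" by (rule locally_optimal_spanning_tree) simp
  from max_spanning_tree_is_max(1)[OF finite_E this]
  have "finite (max_spanning_tree V E (indicator_weight F))"
    using finite_E finite_subset unfolding spanning_tree_of_def by blast
  then show ?thesis
    using sum_indicator_weight_E[OF assms] by (auto simp: weighting_ratio_def sum_indicator_weight)
qed

text \<open>Fractions with denominators at most \<open>m\<close> differ by at least \<open>1 / m\<^sup>2\<close>.\<close>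

lemma fraction_le_of_close:
  fixes p q r s m :: nat
  assumes "0 < q" "q \<le> m" "0 < s" "s \<le> m" "real r / real s \<le> real p / real q + \<delta>" "\<delta> * (real m)\<^sup>2 < 1" "0 \<le> \<delta>"
  shows "real r / real s \<le> real p / real q"
proof -
  have "real r * real q \<le> real p * real s + \<delta> * (real q * real s)"
    using assms(1,3,5) by (simp add: field_simps)
  also have "\<delta> * (real q * real s) \<le> \<delta> * (real m)\<^sup>2"
    using assms by (intro mult_left_mono) (auto simp: power2_eq_square intro: mult_mono)
  finally have "real (r * q) < real (p * s + 1)" using assms(6) by simp
  then have "r * q \<le> p * s" by linarith
  then have "real r * real q \<le> real p * real s" by (metis of_nat_mult of_nat_le_iff)
  then show ?thesis using assms(1,3) by (simp add: field_simps)
qed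

text \<open>The ratio of \<open>L\<close> exceeds that of the best indicator by less than the least
  distance between different fractions with such denominators, so it does not exceed it at all. The
  value is expressed by member 0 because the program reads it off there.\<close>

theorem local_optimum_is_optimal:
  assumes lo: "locally_optimal V E K Tr" and gap: "load_gap E (load K Tr) j"
    and K: "card E ^ 3 \<le> K" and L: "L = {e \<in> E. load K Tr e \<le> j}"
  shows "L \<noteq> {}" "indicator_weight L \<in> weightings E"
    "weighting_ratio V E (indicator_weight L) = min_weighting_ratio V E"
    "min_weighting_ratio V E = real (card (Tr 0 \<inter> L)) / real (card L)"
proof -
  let ?m = "card E" and ?r = "\<lambda>F. weighting_ratio V E (indicator_weight F)"
  have m: "0 < ?m" by (rule card_E_pos)
  then have K0: "0 < K" using K by (metis gr0I le_zero_eq not_less_zero power_not_zero)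
  show ne: "L \<noteq> {}" using gap by (auto simp: L load_gap_def)
  have LE: "L \<subseteq> E" by (auto simp: L)
  show w: "indicator_weight L \<in> weightings E" by (rule indicator_weight_weighting[OF LE ne])
  obtain F where F: "F \<subseteq> E" "F \<noteq> {}"
    "\<And>\<omega>. \<omega> \<in> weightings E \<Longrightarrow> ?r F \<le> weighting_ratio V E \<omega>" using best_indicator by blast
  obtain p where p: "?r F = real p / real (card F)" using indicator_weight_ratio_fraction[OF F(1)] by blast
  have ratio: "?r L = real (card (Tr 0 \<inter> L)) / real (card L)"
    by (rule indicator_weight_ratio[OF lo gap K0 L])
  have "?r L \<le> ?r F"
    unfolding p unfolding ratio
  proof (rule fraction_le_of_close)
    have fin: "finite F" "finite L" using F(1) LE finite_E finite_subset by blast+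
    show "0 < card F" "0 < card L" using fin F(2) ne by (auto simp: card_gt_0_iff)
    show "card F \<le> ?m" "card L \<le> ?m" using F(1) LE finite_E by (auto intro: card_mono)
    show "real (card (Tr 0 \<inter> L)) / real (card L) \<le> real p / real (card F) + (real ?m - 1) / real K"
      using load_gap_ratio_le[OF lo gap K0 L indicator_weight_weighting[OF F(1,2)]] p ratio by simp
    show "0 \<le> (real ?m - 1) / real K" using m by simp
    \<comment> \<open>Here the cube is needed: the error \<open>(m - 1) / K\<close> has to stay
      below \<open>1 / m^2\<close>, where \<open>m = card E\<close>.\<close>
    have "(real ?m - 1) * (real ?m)\<^sup>2 < real ?m ^ 3"
      using m by (simp add: power3_eq_cube power2_eq_square left_diff_distrib)
    also have "\<dots> \<le> real K" using K by (metis of_nat_le_iff of_nat_power)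
    finally show "(real ?m - 1) / real K * (real ?m)\<^sup>2 < 1" using K0 by (simp add: field_simps)
  qed
  then have min: "?r L \<le> weighting_ratio V E \<omega>" if "\<omega> \<in> weightings E" for \<omega>
    using F(3)[OF that] by linarith
  have "min_weighting_ratio V E = ?r L"
    unfolding min_weighting_ratio_def
    by (rule cInf_eq_minimum) (use w min in auto)
  then show "?r L = min_weighting_ratio V E"
    "min_weighting_ratio V E = real (card (Tr 0 \<inter> L)) / real (card L)" using ratio by simp_all
qed

end

section \<open>Running times of programs\<close>

text \<open>Total correctness with a time bound. Bounding the time from above allows weakening, and
  the existence of a run is enough since \<open>exec\<close> is deterministic.\<close>

definition runs :: "com \<Rightarrow> state \<Rightarrow> nat \<Rightarrow> (state \<Rightarrow> bool) \<Rightarrow> bool" where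
  "runs c s T Q \<longleftrightarrow> (\<exists>t s'. exec c s t s' \<and> t \<le> T \<and> Q s')"

lemma runs_mono: "runs c s T Q \<Longrightarrow> T \<le> T' \<Longrightarrow> (\<And>s'. Q s' \<Longrightarrow> Q' s') \<Longrightarrow> runs c s T' Q'"
  unfolding runs_def by (meson le_trans)

lemma runs_Seq:
  assumes "runs c1 s T1 P" "\<And>s'. P s' \<Longrightarrow> runs c2 s' T2 Q"
  shows "runs (Seq c1 c2) s (T1 + T2) Q"
proof -
  obtain t1 s1 where 1: "exec c1 s t1 s1" "t1 \<le> T1" "P s1" using assms(1) by (auto simp: runs_def)
  obtain t2 s2 where 2: "exec c2 s1 t2 s2" "t2 \<le> T2" "Q s2" using assms(2)[OF 1(3)] by (auto simp: runs_def)
  show ?thesis unfolding runs_def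
    using exec_Seq[OF 1(1) 2(1)] 1(2) 2(2,3) add_mono by blast
qed

text \<open>The values of \<open>effect\<close> and \<open>ccost\<close> at loops are junk: both are used only for loop-free programs.\<close>

primrec effect :: "com \<Rightarrow> state \<Rightarrow> state" where
  "effect Skip s = s"
| "effect (Assign x i a) s = s(x := (s x)(aval i s := aval a s))"
| "effect (Seq c1 c2) s = effect c2 (effect c1 s)"
| "effect (Cond b c1 c2) s = (if bval b s then effect c1 s else effect c2 s)"
| "effect (While b c) s = s"

fun ccost :: "com \<Rightarrow> nat" where
  "ccost Skip = 1"
| "ccost (Assign x i a) = 1 + acost i + acost a"
| "ccost (Seq c1 c2) = ccost c1 + ccost c2"
| "ccost (Cond b c1 c2) = 1 + bcost b + ccost c1 + ccost c2"
| "ccost (While b c) = 0"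

fun loop_free :: "com \<Rightarrow> bool" where
  "loop_free (Seq c1 c2) \<longleftrightarrow> loop_free c1 \<and> loop_free c2"
| "loop_free (Cond b c1 c2) \<longleftrightarrow> loop_free c1 \<and> loop_free c2"
| "loop_free (While b c) \<longleftrightarrow> False"
| "loop_free _ \<longleftrightarrow> True"

lemma exec_loop_free: "loop_free c \<Longrightarrow> \<exists>t\<le>ccost c. exec c s t (effect c s)"
proof (induction c arbitrary: s)
  case Skip
  show ?case using exec_Skip by auto
next
  case (Assign x i a)
  show ?case using exec_Assign[of x i a s] by (intro exI[of _ "1 + acost i + acost a"]) (simp only: effect.simps ccost.simps order_refl simp_thms)
next
  case (Seq c1 c2)
  then show ?case by simp (meson add_mono exec_Seq)
next
  case (Cond b c1 c2)
  then obtain t1 t2 where t: "t1 \<le> ccost c1" "exec c1 s t1 (effect c1 s)"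
    "t2 \<le> ccost c2" "exec c2 s t2 (effect c2 s)" by fastforce
  show ?case
  proof (cases "bval b s")
    case True
    then show ?thesis using exec_CondTrue[OF True t(2), of c2] t(1)
      by (intro exI[of _ "1 + bcost b + t1"]) auto
  next
    case False
    then show ?thesis using exec_CondFalse[OF False t(4), of c1] t(3)
      by (intro exI[of _ "1 + bcost b + t2"]) auto
  qed
qed simp

lemma runs_loop_free: "loop_free c \<Longrightarrow> Q (effect c s) \<Longrightarrow> runs c s (ccost c) Q"
  unfolding runs_def using exec_loop_free by blast

section \<open>Frame conditions and loops\<close>

fun written :: "com \<Rightarrow> vname set" where
  "written Skip = {}"
| "written (Assign x i a) = {x}"
| "written (Seq c1 c2) = written c1 \<union> written c2"
| "written (Cond b c1 c2) = written c1 \<union> written c2"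
| "written (While b c) = written c"

lemma exec_unwritten: "exec c s t s' \<Longrightarrow> x \<notin> written c \<Longrightarrow> s' x = s x"
  by (induction rule: exec.induct) auto

text \<open>\<open>\<mu>\<close> bounds the number of iterations, and the \<open>+ 1\<close> covers
  the final test. The frame relative to the initial state is built in, so that invariants need not
  repeat what the body leaves alone.\<close>

lemma runs_While:
  assumes body: "\<And>s'. I s' \<Longrightarrow> \<forall>x. x \<notin> written c \<longrightarrow> s' x = s x \<Longrightarrow> bval b s' \<Longrightarrow>
      runs c s' Tb (\<lambda>s''. I s'' \<and> (\<mu> s'' :: nat) < \<mu> s')"
    and init: "I s" "\<mu> s \<le> M"
  shows "runs (While b c) s ((M + 1) * (1 + bcost b + Tb))
    (\<lambda>s'. I s' \<and> \<not> bval b s' \<and> (\<forall>x. x \<notin> written c \<longrightarrow> s' x = s x))"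
proof -
  have "\<exists>t s2. exec (While b c) s1 t s2 \<and> t \<le> (\<mu> s1 + 1) * (1 + bcost b + Tb) \<and> I s2 \<and> \<not> bval b s2"
    if "I s1" "\<forall>x. x \<notin> written c \<longrightarrow> s1 x = s x" for s1
    using that
  proof (induction "\<mu> s1" arbitrary: s1 rule: less_induct)
    case less
    show ?case
    proof (cases "bval b s1")
      case False
      then show ?thesis using exec_WhileFalse[OF False, of c] less.prems
        by (intro exI[of _ "1 + bcost b"] exI[of _ s1]) auto
    next
      case True
      obtain t s2 where s2: "exec c s1 t s2" "t \<le> Tb" "I s2" "\<mu> s2 < \<mu> s1"
        using body[OF less.prems True] by (auto simp: runs_def)
      have "\<forall>x. x \<notin> written c \<longrightarrow> s2 x = s x" using exec_unwritten[OF s2(1)] less.prems(2) by auto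
      then obtain u s3 where s3: "exec (While b c) s2 u s3" "u \<le> (\<mu> s2 + 1) * (1 + bcost b + Tb)"
        "I s3" "\<not> bval b s3" using less.hyps[OF s2(4,3)] by blast
      have "(\<mu> s2 + 1) * (1 + bcost b + Tb) \<le> \<mu> s1 * (1 + bcost b + Tb)"
        using s2(4) by (intro mult_right_mono) auto
      then have "1 + bcost b + t + u \<le> (\<mu> s1 + 1) * (1 + bcost b + Tb)"
        using s2(2) s3(2) by simp
      then show ?thesis using exec_WhileTrue[OF True s2(1) s3(1)] s3(3,4) by blast
    qed
  qed
  from this[OF init(1)] obtain t s2 where r: "exec (While b c) s t s2"
    "t \<le> (\<mu> s + 1) * (1 + bcost b + Tb)" "I s2" "\<not> bval b s2" by auto
  have "(\<mu> s + 1) * (1 + bcost b + Tb) \<le> (M + 1) * (1 + bcost b + Tb)"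
    using init(2) by (intro mult_right_mono) auto
  then show ?thesis unfolding runs_def
    using r exec_unwritten[OF r(1)] by (intro exI[of _ t] exI[of _ s2]) auto
qed

lemmas runs_While_loop_free = runs_While[OF runs_loop_free]

abbreviation var :: "vname \<Rightarrow> aexp" where "var x \<equiv> Cell x (Lit 0)"
abbreviation set_var :: "vname \<Rightarrow> aexp \<Rightarrow> com" where "set_var x a \<equiv> Assign x (Lit 0) a"
abbreviation incr :: "vname \<Rightarrow> com" where "incr x \<equiv> set_var x (Add (var x) (Lit 1))"

definition eqb :: "aexp \<Rightarrow> aexp \<Rightarrow> bexp" where
  "eqb a b = Conj (Neg (Less a b)) (Neg (Less b a))"

definition orb :: "bexp \<Rightarrow> bexp \<Rightarrow> bexp" where
  "orb a b = Neg (Conj (Neg a) (Neg b))"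

lemma bval_eqb [simp]: "bval (eqb a b) s \<longleftrightarrow> aval a s = aval b s"
  by (auto simp: eqb_def)

lemma bval_orb [simp]: "bval (orb a b) s \<longleftrightarrow> bval a s \<or> bval b s"
  by (simp add: orb_def)

definition times_body :: "vname \<Rightarrow> vname \<Rightarrow> com" where
  "times_body y z = Seq (set_var z (Add (var z) (var y))) (incr ''k'')"

text \<open>The machine has no multiplication, so \<open>y\<close> is added \<open>x\<close> times.
  Taking \<open>x = y\<close> gives the squares needed for the loop limit.\<close>

definition times_com :: "vname \<Rightarrow> vname \<Rightarrow> vname \<Rightarrow> com" where
  "times_com x y z = Seq (Seq (set_var z (Lit 0)) (set_var ''k'' (Lit 0)))
     (While (Less (var ''k'') (var x)) (times_body y z))"

lemma runs_times_com:
  assumes "x \<noteq> z" "y \<noteq> z" "x \<noteq> ''k''" "y \<noteq> ''k''" "z \<noteq> ''k''" "s x 0 \<le> N"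
  shows "runs (times_com x y z) s (100 * (N + 1))
    (\<lambda>s'. s' z 0 = s x 0 * s y 0 \<and> (\<forall>w. w \<notin> {z, ''k''} \<longrightarrow> s' w = s w))"
proof -
  let ?P = "\<lambda>s'. s' z 0 = 0 \<and> s' ''k'' 0 = 0 \<and> (\<forall>w. w \<notin> {z, ''k''} \<longrightarrow> s' w = s w)"
  have 1: "runs (Seq (set_var z (Lit 0)) (set_var ''k'' (Lit 0))) s (ccost (Seq (set_var z (Lit 0)) (set_var ''k'' (Lit 0)))) ?P"
    by (rule runs_loop_free) (use assms in auto)
  have 2: "runs (While (Less (var ''k'') (var x)) (times_body y z)) s1
     ((N + 1) * (1 + bcost (Less (var ''k'') (var x)) + ccost (times_body y z)))
     (\<lambda>s'. s' z 0 = s x 0 * s y 0 \<and> (\<forall>w. w \<notin> {z, ''k''} \<longrightarrow> s' w = s w))" if s1: "?P s1" for s1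
  proof -
    let ?I = "\<lambda>s'. s' z 0 = s' ''k'' 0 * s y 0 \<and> s' ''k'' 0 \<le> s x 0"
    let ?m = "\<lambda>s'. s x 0 - s' ''k'' 0"
    have "runs (While (Less (var ''k'') (var x)) (times_body y z)) s1
       ((N + 1) * (1 + bcost (Less (var ''k'') (var x)) + ccost (times_body y z)))
       (\<lambda>s'. ?I s' \<and> \<not> bval (Less (var ''k'') (var x)) s' \<and>
          (\<forall>w. w \<notin> written (times_body y z) \<longrightarrow> s' w = s1 w))"
    proof (rule runs_While_loop_free[where \<mu> = ?m])
      fix s'
      assume I: "?I s'" and fr: "\<forall>w. w \<notin> written (times_body y z) \<longrightarrow> s' w = s1 w"
        and b: "bval (Less (var ''k'') (var x)) s'"
      have "s' x = s x" "s' y = s y" using fr s1 assms by (auto simp: times_body_def)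
      then show "?I (effect (times_body y z) s') \<and> ?m (effect (times_body y z) s') < ?m s'"
        using I b assms by (auto simp: times_body_def)
    qed (use s1 assms in \<open>auto simp: times_body_def\<close>)
    then show ?thesis
      by (rule runs_mono) (use s1 assms in \<open>auto simp: times_body_def\<close>)
  qed
  show ?thesis
    unfolding times_com_def
    by (rule runs_mono[OF runs_Seq[OF 1 2]]) (auto simp: times_body_def)
qed

section \<open>Graphs presented by edge arrays\<close>

locale edge_list =
  fixes n m :: nat and src dst :: "nat \<Rightarrow> nat"
  assumes ends: "k < m \<Longrightarrow> src k < n \<and> dst k < n \<and> src k \<noteq> dst k"
    and inj: "inj_on (\<lambda>k. {src k, dst k}) {..<m}"
    and m_pos: "0 < m"
    and conn: "graph_connected {..<n} ((\<lambda>k. {src k, dst k}) ` {..<m})"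
begin

definition ed :: "nat \<Rightarrow> nat set" where
  "ed k = {src k, dst k}"

abbreviation E :: "nat set set" where
  "E \<equiv> ed ` {..<m}"

lemma ed_eq_iff: "k < m \<Longrightarrow> l < m \<Longrightarrow> ed k = ed l \<longleftrightarrow> k = l"
  using inj by (auto simp: ed_def inj_on_def)

lemma simple_E: "simple_graph {..<n} E"
  using ends by (fastforce simp: simple_graph_def ed_def)

sublocale connected_graph "{..<n}" E
proof
  show "graph_connected {..<n} E" using conn by (simp add: ed_def[abs_def])
qed (use simple_E m_pos in auto)

lemma card_E: "card E = m"
  using card_image[of ed "{..<m}"] ed_eq_iff by (auto simp: inj_on_def)

lemma n_pos: "0 < n"
  using ends[OF m_pos] by simp

text \<open>Different edges have different endpoint pairs. This turns a time bound in
  \<open>n\<close> and \<open>m\<close> into one in \<open>n\<close> alone.\<close>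

lemma m_le: "m \<le> n * n"
proof -
  have "inj_on (\<lambda>k. (src k, dst k)) {..<m}" using inj by (auto simp: inj_on_def)
  then have "card ((\<lambda>k. (src k, dst k)) ` {..<m}) = m" by (simp add: card_image)
  moreover have "card ((\<lambda>k. (src k, dst k)) ` {..<m}) \<le> card ({..<n} \<times> {..<n})"
    using ends by (intro card_mono) auto
  ultimately show ?thesis by (simp add: card_cartesian_product)
qed

definition is_input :: "state \<Rightarrow> bool" where
  "is_input s \<longleftrightarrow> s ''n'' 0 = n \<and> s ''m'' 0 = m \<and> (\<forall>k<m. s ''src'' k = src k \<and> s ''dst'' k = dst k)"

end

section \<open>Testing connectivity by spreading marks\<close>

definition reset_body :: com where
  "reset_body = Seq (Assign ''mark'' (var ''k'') (Lit 0)) (incr ''k'')"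

text \<open>
  Row \<open>i\<close> (cells \<open>i m, \<dots>, i m + m - 1\<close>) of the array \<open>C\<close> is the complement of the \<open>i\<close>-th edge set, and \<open>cl\<close> counts the edge
  sets that miss a given edge. The zero-initialised memory therefore describes a family in
  which every member is the whole edge set. The variable \<open>base\<close> holds \<open>i m\<close> for the member under
  consideration, and \<open>active\<close> tests whether edge \<open>k\<close> belongs to that member plus \<open>f\<close> minus \<open>e\<close>.
\<close>

definition active :: bexp where
  "active = Conj (Neg (eqb (var ''k'') (var ''e'')))
     (orb (eqb (var ''k'') (var ''f'')) (Less (Cell ''C'' (Add (var ''base'') (var ''k''))) (Lit 1)))"

text \<open>An active edge with exactly one marked end spreads the mark, and the scan starts over at
  edge 0. A pass that reaches the last edge thus certifies that marks are constant along active
  edges.\<close>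

definition reach_body :: com where
  "reach_body = Cond
     (Conj active (Neg (eqb (Cell ''mark'' (Cell ''src'' (var ''k''))) (Cell ''mark'' (Cell ''dst'' (var ''k''))))))
     (Seq (Assign ''mark'' (Cell ''src'' (var ''k'')) (Lit 1))
     (Seq (Assign ''mark'' (Cell ''dst'' (var ''k'')) (Lit 1))
     (Seq (incr ''cnt'') (set_var ''k'' (Lit 0)))))
     (incr ''k'')"

definition reach_init :: com where
  "reach_init = Seq (Assign ''mark'' (Lit 0) (Lit 1)) (Seq (set_var ''cnt'' (Lit 1)) (set_var ''k'' (Lit 0)))"

definition check_com :: com where
  "check_com = Seq (Seq (set_var ''k'' (Lit 0)) (While (Less (var ''k'') (var ''n'')) reset_body))
     (Seq reach_init (While (Less (var ''k'') (var ''m'')) reach_body))"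

context edge_list
begin

definition active_edges :: "state \<Rightarrow> nat set set" where
  "active_edges s = {ed k | k. k < m \<and> k \<noteq> s ''e'' 0 \<and> (k = s ''f'' 0 \<or> s ''C'' (s ''base'' 0 + k) = 0)}"

definition marked :: "state \<Rightarrow> nat set" where
  "marked s = {v. v < n \<and> s ''mark'' v = 1}"

text \<open>Soundness (marked vertices are reachable from 0) together with completeness so far (no
  edge before \<open>k\<close> can spread a mark).\<close>

definition reach_inv :: "state \<Rightarrow> state \<Rightarrow> bool" where
  "reach_inv s0 s \<longleftrightarrow> (\<forall>v<n. s ''mark'' v \<le> 1) \<and> s ''mark'' 0 = 1 \<and> s ''cnt'' 0 = card (marked s) \<and>
     (\<forall>v\<in>marked s. (0, v) \<in> (adj (active_edges s0))\<^sup>*) \<and> s ''k'' 0 \<le> m \<and>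
     (\<forall>k<s ''k'' 0. ed k \<in> active_edges s0 \<longrightarrow> s ''mark'' (src k) = s ''mark'' (dst k))"

lemma finite_marked: "finite (marked s)"
  by (simp add: marked_def)

lemma card_marked_le: "card (marked s) \<le> n"
  using card_mono[of "{..<n}" "marked s"] by (auto simp: marked_def)

lemma reset_runs:
  assumes "is_input s"
  shows "runs (Seq (set_var ''k'' (Lit 0)) (While (Less (var ''k'') (var ''n'')) reset_body)) s (100 * (n + 1))
    (\<lambda>s'. (\<forall>v<n. s' ''mark'' v = 0) \<and> (\<forall>w. w \<notin> {''mark'', ''k''} \<longrightarrow> s' w = s w))"
proof -
  let ?P = "\<lambda>s'. s' ''k'' 0 = 0 \<and> (\<forall>w. w \<noteq> ''k'' \<longrightarrow> s' w = s w)"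
  have 1: "runs (set_var ''k'' (Lit 0)) s (ccost (set_var ''k'' (Lit 0))) ?P"
    by (rule runs_loop_free) auto
  have 2: "runs (While (Less (var ''k'') (var ''n'')) reset_body) s1
     ((n + 1) * (1 + bcost (Less (var ''k'') (var ''n'')) + ccost reset_body))
     (\<lambda>s'. (\<forall>v<n. s' ''mark'' v = 0) \<and> (\<forall>w. w \<notin> {''mark'', ''k''} \<longrightarrow> s' w = s w))" if s1: "?P s1" for s1
  proof -
    let ?I = "\<lambda>s'. s' ''n'' 0 = n \<and> (\<forall>v<s' ''k'' 0. s' ''mark'' v = 0) \<and> s' ''k'' 0 \<le> n"
    let ?m = "\<lambda>s'. n - s' ''k'' 0"
    have "runs (While (Less (var ''k'') (var ''n'')) reset_body) s1
       ((n + 1) * (1 + bcost (Less (var ''k'') (var ''n'')) + ccost reset_body))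
       (\<lambda>s'. ?I s' \<and> \<not> bval (Less (var ''k'') (var ''n'')) s' \<and>
          (\<forall>w. w \<notin> written reset_body \<longrightarrow> s' w = s1 w))"
    proof (rule runs_While_loop_free[where \<mu> = ?m])
      fix s'
      assume "?I s'" and "bval (Less (var ''k'') (var ''n'')) s'"
      then show "?I (effect reset_body s') \<and> ?m (effect reset_body s') < ?m s'"
        by (auto simp: reset_body_def less_Suc_eq)
    qed (use s1 assms in \<open>auto simp: reset_body_def is_input_def\<close>)
    then show ?thesis
      by (rule runs_mono) (use s1 in \<open>auto simp: reset_body_def\<close>)
  qed
  show ?thesis
    by (rule runs_mono[OF runs_Seq[OF 1 2]]) (auto simp: reset_body_def)
qed

lemma active_iff:
  assumes "is_input s" "s ''k'' 0 < m" "s ''e'' = s0 ''e''" "s ''f'' = s0 ''f''" "s ''C'' = s0 ''C''"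
    "s ''base'' = s0 ''base''"
  shows "bval active s \<longleftrightarrow> ed (s ''k'' 0) \<in> active_edges s0"
  using assms ed_eq_iff by (auto simp: active_def active_edges_def)

text \<open>The measure is lexicographic: the factor \<open>m + 1\<close> lets one newly marked
  vertex pay for a new scan over \<open>m\<close> edges.\<close>

lemma reach_step:
  assumes inp: "is_input s" and fr: "s ''e'' = s0 ''e''" "s ''f'' = s0 ''f''" "s ''C'' = s0 ''C''"
    "s ''base'' = s0 ''base''" and I: "reach_inv s0 s" and k: "s ''k'' 0 < m"
  defines "s' \<equiv> effect reach_body s"
  shows "reach_inv s0 s' \<and> (n - s' ''cnt'' 0) * (m + 1) + (m - s' ''k'' 0) < (n - s ''cnt'' 0) * (m + 1) + (m - s ''k'' 0)"
proof -
  define k where "k = s ''k'' 0"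
  have km: "k < m" using k by (simp add: k_def)
  have sd: "s ''src'' k = src k" "s ''dst'' k = dst k" using inp km by (auto simp: is_input_def)
  have sn: "src k < n" "dst k < n" using ends[OF km] by auto
  have act: "bval active s \<longleftrightarrow> ed k \<in> active_edges s0"
    unfolding k_def by (rule active_iff[OF inp k fr])
  let ?b = "ed k \<in> active_edges s0 \<and> s ''mark'' (src k) \<noteq> s ''mark'' (dst k)"
  show ?thesis
  proof (cases ?b)
    case False
    have s': "s' = s(''k'' := (s ''k'')(0 := k + 1))"
      unfolding s'_def reach_body_def using False act sd by (auto simp: k_def)
    have "marked s' = marked s" by (simp add: marked_def s')
    then show ?thesis using I False km unfolding reach_inv_def
      by (auto simp: s' k_def[symmetric] less_Suc_eq)
  next
    case True
    define M where "M = (s ''mark'')(src k := 1, dst k := 1)"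
    have s': "s' = s(''mark'' := M, ''cnt'' := (s ''cnt'')(0 := s ''cnt'' 0 + 1), ''k'' := (s ''k'')(0 := 0))"
      unfolding s'_def reach_body_def M_def using True act sd by (simp add: k_def[symmetric])
    have le: "s ''mark'' (src k) \<le> 1" "s ''mark'' (dst k) \<le> 1" using I sn by (auto simp: reach_inv_def)
    \<comment> \<open>\<open>a\<close> is the marked end and \<open>b\<close> the unmarked one;
      marks are 0 or 1, so unequal marks leave no other case.\<close>
    obtain a b where ab: "s ''mark'' a = 1" "s ''mark'' b = 0" "ed k = {a, b}" "a < n" "b < n"
      "{a, b} = {src k, dst k}"
    proof (cases "s ''mark'' (src k) = 1")
      case True
      then show ?thesis using \<open>?b\<close> le sn that[of "src k" "dst k"] by (auto simp: ed_def)
    next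
      case False
      then show ?thesis using \<open>?b\<close> le sn that[of "dst k" "src k"] by (auto simp: ed_def)
    qed
    have Mv: "M v = (if v = a \<or> v = b then 1 else s ''mark'' v)" for v
      using ab(6) by (auto simp: M_def doubleton_eq_iff)
    have mk: "marked s' = insert b (marked s)" using ab by (auto simp: marked_def s' Mv)
    have "b \<notin> marked s" using ab by (simp add: marked_def)
    then have cM: "card (marked s') = card (marked s) + 1" using finite_marked by (simp add: mk)
    have "a \<in> marked s" using ab by (simp add: marked_def)
    then have "(0, a) \<in> (adj (active_edges s0))\<^sup>*" using I by (simp add: reach_inv_def)
    then have rb: "(0, b) \<in> (adj (active_edges s0))\<^sup>*"
      by (rule adj_rtrancl_step) (use True ab in simp)
    have "reach_inv s0 s'"
      using I cM rb unfolding reach_inv_def mk by (auto simp: s' Mv)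
    moreover have "(n - s' ''cnt'' 0) * (m + 1) + (m - s' ''k'' 0) < (n - s ''cnt'' 0) * (m + 1) + (m - s ''k'' 0)"
    proof -
      have "s' ''cnt'' 0 = s ''cnt'' 0 + 1" "s' ''cnt'' 0 \<le> n"
        using calculation card_marked_le[of s'] by (auto simp: reach_inv_def s')
      \<comment> \<open>Since the new count is still at most \<open>n\<close>, the truncated
        difference really drops by 1.\<close>
      then obtain d where "n = s ''cnt'' 0 + 1 + d" using le_Suc_ex by metis
      then show ?thesis using \<open>s' ''cnt'' 0 = s ''cnt'' 0 + 1\<close> by simp
    qed
    ultimately show ?thesis by simp
  qed
qed

text \<open>After a complete pass the marks are constant on components, so all vertices are marked
  exactly if all are reachable from 0.\<close>

lemma reach_inv_final:
  assumes I: "reach_inv s0 s" and k: "\<not> s ''k'' 0 < m"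
  shows "n \<le> s ''cnt'' 0 \<longleftrightarrow> graph_connected {..<n} (active_edges s0)"
proof
  assume "n \<le> s ''cnt'' 0"
  then have "card (marked s) = card {..<n}" using I card_marked_le[of s] by (auto simp: reach_inv_def)
  moreover have "marked s \<subseteq> {..<n}" by (auto simp: marked_def)
  ultimately have "marked s = {..<n}" by (simp add: card_subset_eq)
  then have r: "\<And>v. v < n \<Longrightarrow> (0, v) \<in> (adj (active_edges s0))\<^sup>*" using I by (auto simp: reach_inv_def)
  then show "graph_connected {..<n} (active_edges s0)"
    using n_pos unfolding graph_connected_iff
    by (auto simp: lessThan_empty_iff intro: rtrancl_trans[OF sym_adj_rtrancl[OF r] r])
next
  assume c: "graph_connected {..<n} (active_edges s0)"
  have cl: "s ''mark'' a = s ''mark'' b" if e: "{a, b} \<in> active_edges s0" for a b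
  proof -
    obtain l where l: "l < m" "ed l = {a, b}" using e by (auto simp: active_edges_def)
    then have "s ''mark'' (src l) = s ''mark'' (dst l)" using I k that by (auto simp: reach_inv_def)
    then show ?thesis using l by (auto simp: ed_def doubleton_eq_iff)
  qed
  have "s ''mark'' v = 1" if "v < n" for v
  proof -
    have "(0, v) \<in> (adj (active_edges s0))\<^sup>*" using c n_pos that by (auto simp: graph_connected_iff)
    then have "s ''mark'' 0 = s ''mark'' v" by (rule adj_rtrancl_invariant) (rule cl)
    then show ?thesis using I by (simp add: reach_inv_def)
  qed
  then have "marked s = {..<n}" by (auto simp: marked_def)
  then show "n \<le> s ''cnt'' 0" using I by (simp add: reach_inv_def)
qed

lemma check_runs:
  assumes inp: "is_input s"
  shows "runs check_com s (1000 * (n + 1) * (m + 1))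
    (\<lambda>s'. (n \<le> s' ''cnt'' 0 \<longleftrightarrow> graph_connected {..<n} (active_edges s)) \<and>
       (\<forall>w. w \<notin> {''mark'', ''k'', ''cnt''} \<longrightarrow> s' w = s w))"
proof -
  let ?P1 = "\<lambda>s'. (\<forall>v<n. s' ''mark'' v = 0) \<and> (\<forall>w. w \<notin> {''mark'', ''k''} \<longrightarrow> s' w = s w)"
  let ?P2 = "\<lambda>s'. reach_inv s s' \<and> (\<forall>w. w \<notin> {''mark'', ''k'', ''cnt''} \<longrightarrow> s' w = s w)"
  let ?Q = "\<lambda>s'. (n \<le> s' ''cnt'' 0 \<longleftrightarrow> graph_connected {..<n} (active_edges s)) \<and>
       (\<forall>w. w \<notin> {''mark'', ''k'', ''cnt''} \<longrightarrow> s' w = s w)"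
  let ?m = "\<lambda>s. (n - s ''cnt'' 0) * (m + 1) + (m - s ''k'' 0)"
  have 2: "runs reach_init s1 (ccost reach_init) ?P2" if s1: "?P1 s1" for s1
  proof (rule runs_loop_free)
    define s2 where "s2 = effect reach_init s1"
    have mk: "s2 ''mark'' v = (if v = 0 then 1 else 0)" if "v < n" for v
      using s1 that by (simp add: s2_def reach_init_def)
    have vars: "s2 ''cnt'' 0 = 1" "s2 ''k'' 0 = 0" by (simp_all add: s2_def reach_init_def)
    have fr: "s2 w = s w" if "w \<notin> {''mark'', ''k'', ''cnt''}" for w
      using s1 that by (simp add: s2_def reach_init_def)
    have "marked s2 = {0}" using mk n_pos by (auto simp: marked_def split: if_splits)
    then have "reach_inv s s2" using mk n_pos vars by (simp add: reach_inv_def)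
    then show "?P2 (effect reach_init s1)" using fr by (simp add: s2_def)
  qed (simp add: reach_init_def)
  have 3: "runs (While (Less (var ''k'') (var ''m'')) reach_body) s2
     ((n * (m + 1) + m + 1) * (1 + bcost (Less (var ''k'') (var ''m'')) + ccost reach_body)) ?Q"
    if s2: "?P2 s2" for s2
  proof -
    have "runs (While (Less (var ''k'') (var ''m'')) reach_body) s2
     ((n * (m + 1) + m + 1) * (1 + bcost (Less (var ''k'') (var ''m'')) + ccost reach_body))
     (\<lambda>s'. reach_inv s s' \<and> \<not> bval (Less (var ''k'') (var ''m'')) s' \<and>
       (\<forall>w. w \<notin> written reach_body \<longrightarrow> s' w = s2 w))"
    proof (rule runs_While_loop_free[where \<mu> = ?m])
      fix s'
      assume I: "reach_inv s s'" and fr: "\<forall>w. w \<notin> written reach_body \<longrightarrow> s' w = s2 w"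
        and b: "bval (Less (var ''k'') (var ''m'')) s'"
      have fr': "\<forall>w. w \<notin> {''mark'', ''k'', ''cnt''} \<longrightarrow> s' w = s w"
        using fr s2 by (auto simp: reach_body_def)
      then have "is_input s'" using inp by (auto simp: is_input_def)
      moreover have "s' ''k'' 0 < m" using b fr' inp by (auto simp: is_input_def)
      ultimately show "reach_inv s (effect reach_body s') \<and> ?m (effect reach_body s') < ?m s'"
        using I fr' by (intro reach_step) auto
    next
      show "?m s2 \<le> n * (m + 1) + m" by (intro add_mono mult_right_mono) auto
    qed (use s2 in \<open>auto simp: reach_body_def\<close>)
    then show ?thesis
    proof (rule runs_mono)
      fix s' assume a: "reach_inv s s' \<and> \<not> bval (Less (var ''k'') (var ''m'')) s' \<and>
       (\<forall>w. w \<notin> written reach_body \<longrightarrow> s' w = s2 w)"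
      then have fr': "\<forall>w. w \<notin> {''mark'', ''k'', ''cnt''} \<longrightarrow> s' w = s w"
        using s2 by (auto simp: reach_body_def)
      then have "\<not> s' ''k'' 0 < m" using a inp by (auto simp: is_input_def)
      then show "?Q s'" using reach_inv_final[of s s'] a fr' by blast
    qed simp
  qed
  show ?thesis unfolding check_com_def
    by (rule runs_mono[OF runs_Seq[OF reset_runs[OF inp] runs_Seq[OF 2 3]]])
      (auto simp: reach_init_def reach_body_def active_def eqb_def orb_def algebra_simps)
qed

end

section \<open>Local search\<close>

text \<open>\<open>cl\<close> counts the members missing an edge, so the comparison is reversed: an
  entry of \<open>f\<close> at least 2 above that of \<open>e\<close> means a load at least 2
  below.\<close>

definition candidate :: bexp where
  "candidate = Conj (Less (Cell ''C'' (Add (var ''base'') (var ''e''))) (Lit 1))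
     (orb (eqb (var ''e'') (var ''f''))
       (Neg (Less (Cell ''cl'' (var ''f'')) (Add (Cell ''cl'' (var ''e'')) (Lit 2)))))"

text \<open>Subtracting the old entry of \<open>C\<close> adjusts the count of \<open>f\<close>
  whether it was missing (1) or present (0). Clearing the cell of \<open>f\<close> before setting
  that of \<open>e\<close> makes the case \<open>f = e\<close> a deletion. The scan restarts because
  the new loads may turn rejected moves into improving ones.\<close>

definition update_com :: com where
  "update_com =
     Seq (Assign ''cl'' (var ''f'') (Monus (Cell ''cl'' (var ''f'')) (Cell ''C'' (Add (var ''base'') (var ''f'')))))
    (Seq (Assign ''C'' (Add (var ''base'') (var ''f'')) (Lit 0))
    (Seq (Assign ''C'' (Add (var ''base'') (var ''e'')) (Lit 1))
    (Seq (Assign ''cl'' (var ''e'') (Add (Cell ''cl'' (var ''e'')) (Lit 1)))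
    (Seq (set_var ''base'' (Lit 0)) (Seq (set_var ''e'' (Lit 0)) (set_var ''f'' (Lit 0)))))))"

text \<open>An odometer with \<open>f\<close> running fastest, then \<open>e\<close>, then the row
  offset \<open>base\<close>.\<close>

definition advance_com :: com where
  "advance_com = Seq (incr ''f'') (Cond (Less (var ''f'') (var ''m'')) Skip
     (Seq (set_var ''f'' (Lit 0)) (Seq (incr ''e'') (Cond (Less (var ''e'') (var ''m'')) Skip
       (Seq (set_var ''e'' (Lit 0)) (set_var ''base'' (Add (var ''base'') (var ''m''))))))))"

definition step_com :: com where
  "step_com = Cond (Conj candidate (Neg (Less (var ''cnt'') (var ''n'')))) update_com advance_com"

definition search_com :: com where
  "search_com = While (Less (var ''base'') (var ''lim'')) (Seq check_com step_com)"

lemma flat_index_eq: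
  fixes m :: nat
  assumes "a * m + b = a' * m + b'" "b < m" "b' < m"
  shows "a = a' \<and> b = b'"
proof -
  have "(a * m + b) div m = a" "(a' * m + b') div m = a'" using assms(2,3) by simp_all
  then have "a = a'" using assms(1) by metis
  then show ?thesis using assms(1) by simp
qed

lemma load_le: "load K Tr e \<le> K"
proof -
  have "card {i. i < K \<and> e \<in> Tr i} \<le> card {..<K}" by (rule card_mono) auto
  then show ?thesis by (simp add: load_def)
qed

section \<open>Correctness and termination of the search\<close>

context edge_list
begin

definition K :: nat where "K = m ^ 3"

definition trees :: "state \<Rightarrow> nat \<Rightarrow> nat set set" where
  "trees s i = {ed k | k. k < m \<and> s ''C'' (i * m + k) = 0}"

definition ld :: "state \<Rightarrow> nat \<Rightarrow> nat" where
  "ld s k = load K (trees s) (ed k)"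

definition improving :: "state \<Rightarrow> nat \<Rightarrow> nat \<Rightarrow> nat \<Rightarrow> bool" where
  "improving s i e f \<longleftrightarrow> s ''C'' (i * m + e) = 0 \<and> (e = f \<or> ld s f + 2 \<le> ld s e) \<and>
     graph_connected {..<n} (insert (ed f) (trees s i) - {ed e})"

definition family_inv :: "state \<Rightarrow> bool" where
  "family_inv s \<longleftrightarrow> (\<forall>q. s ''C'' q \<le> 1) \<and> (\<forall>k<m. s ''cl'' k + ld s k = K) \<and>
     (\<forall>i<K. graph_connected {..<n} (trees s i))"

text \<open>With \<open>base = i * m\<close> this is the rank of the triple \<open>(i, e, f)\<close>
  in scanning order.\<close>

definition position :: "state \<Rightarrow> nat" where
  "position s = (s ''base'' 0 + s ''e'' 0) * m + s ''f'' 0"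

text \<open>\<open>i = K\<close> is allowed: it is the state in which all rows have been
  passed.\<close>

definition scan_inv :: "state \<Rightarrow> bool" where
  "scan_inv s \<longleftrightarrow> s ''e'' 0 < m \<and> s ''f'' 0 < m \<and> (\<exists>i\<le>K. s ''base'' 0 = i * m) \<and>
     (\<forall>i<K. \<forall>e<m. \<forall>f<m. (i * m + e) * m + f < position s \<longrightarrow> \<not> improving s i e f)"

definition potential :: "state \<Rightarrow> nat" where
  "potential s = (\<Sum>g\<in>E. (load K (trees s) g)\<^sup>2)"

text \<open>Lexicographic: a unit of potential outweighs every position and pays for a restart, and
  an advance consumes one position. The summand \<open>m * m\<close> leaves room for positions in
  the terminal row \<open>K\<close>.\<close>

definition search_measure :: "state \<Rightarrow> nat" where
  "search_measure s = potential s * (K * m * m + m * m + 1) + (K * m * m + m * m - position s)"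

lemma mem_trees: "k < m \<Longrightarrow> ed k \<in> trees s i \<longleftrightarrow> s ''C'' (i * m + k) = 0"
  using ed_eq_iff by (auto simp: trees_def)

lemma trees_subset: "trees s i \<subseteq> E"
  by (auto simp: trees_def)

lemma search_state_cong:
  assumes "s ''C'' = s' ''C''"
  shows "trees s = trees s'" "ld s = ld s'" "improving s = improving s'" "potential s = potential s'"
  using assms by (simp_all add: trees_def[abs_def] ld_def[abs_def] improving_def[abs_def] potential_def fun_eq_iff)

lemma family_inv_cong:
  assumes "s ''C'' = s' ''C''" "s ''cl'' = s' ''cl''"
  shows "family_inv s = family_inv s'"
  using assms search_state_cong[of s s', OF assms(1)] by (simp add: family_inv_def)

lemma active_edges_move:
  assumes "s ''base'' 0 = i * m" "s ''e'' 0 < m" "s ''f'' 0 < m"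
  shows "active_edges s = insert (ed (s ''f'' 0)) (trees s i) - {ed (s ''e'' 0)}"
  using assms ed_eq_iff by (auto simp: active_edges_def trees_def)

lemma potential_le: "potential s \<le> m * K\<^sup>2"
proof -
  have "potential s \<le> (\<Sum>g\<in>E. K\<^sup>2)" unfolding potential_def
    by (intro sum_mono power_mono load_le) auto
  then show ?thesis by (simp add: card_E)
qed

text \<open>All rows share one array; by \<open>flat_index_eq\<close> the two written cells belong
  to row \<open>i\<close> only.\<close>

lemma trees_update:
  assumes b: "s ''base'' 0 = i * m" and e: "s ''e'' 0 < m" and f: "s ''f'' 0 < m"
  shows "trees (effect update_com s) = (trees s)(i := insert (ed (s ''f'' 0)) (trees s i) - {ed (s ''e'' 0)})"
proof
  fix i'
  let ?e = "s ''e'' 0" and ?f = "s ''f'' 0"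
  have C: "effect update_com s ''C'' = (s ''C'')(i * m + ?f := 0, i * m + ?e := 1)"
    using b by (simp add: update_com_def)
  have idx: "i' * m + k = i * m + l \<longleftrightarrow> i' = i \<and> k = l" if "k < m" "l < m" for k l
    using flat_index_eq[of i' m k i l] that by auto
  show "trees (effect update_com s) i' = ((trees s)(i := insert (ed ?f) (trees s i) - {ed ?e})) i'"
  proof (cases "i' = i")
    case True
    show ?thesis
    proof (intro set_eqI iffI)
      fix x assume "x \<in> trees (effect update_com s) i'"
      then obtain k where k: "x = ed k" "k < m" "((s ''C'')(i * m + ?f := 0, i * m + ?e := 1)) (i * m + k) = 0"
        using C True by (auto simp: trees_def)
      then have "k \<noteq> ?e" by auto
      moreover have "k = ?f \<or> s ''C'' (i * m + k) = 0" using k(3) by (auto split: if_splits)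
      ultimately show "x \<in> ((trees s)(i := insert (ed ?f) (trees s i) - {ed ?e})) i'"
        using True k(1,2) e ed_eq_iff by (auto simp: mem_trees)
    next
      fix x assume "x \<in> ((trees s)(i := insert (ed ?f) (trees s i) - {ed ?e})) i'"
      then have x: "x \<in> insert (ed ?f) (trees s i) - {ed ?e}" using True by simp
      then obtain k where k: "x = ed k" "k < m" "k = ?f \<or> s ''C'' (i * m + k) = 0"
        using f by (auto simp: trees_def)
      moreover have "k \<noteq> ?e" using x k by auto
      ultimately show "x \<in> trees (effect update_com s) i'"
        using True by (auto simp: mem_trees C)
    qed
  next
    case False
    then have "effect update_com s ''C'' (i' * m + k) = s ''C'' (i' * m + k)" if "k < m" for k
      using idx[OF that e] idx[OF that f] by (simp add: C)
    then show ?thesis using False by (auto simp: trees_def)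
  qed
qed

lemma update_step:
  assumes F: "family_inv s" and b: "s ''base'' 0 = i * m" "i < K" and e: "s ''e'' 0 < m" and f: "s ''f'' 0 < m"
    and imp: "improving s i (s ''e'' 0) (s ''f'' 0)"
  shows "family_inv (effect update_com s) \<and> potential (effect update_com s) < potential s"
proof -
  let ?e = "s ''e'' 0" and ?f = "s ''f'' 0" and ?s = "effect update_com s"
  have tr: "trees ?s = (trees s)(i := insert (ed ?f) (trees s i) - {ed ?e})"
    by (rule trees_update[of s i, OF b(1) e f])
  have eT: "ed ?e \<in> trees s i" using imp e by (simp add: mem_trees improving_def)
  have "ed ?f = ed ?e \<or> load K (trees s) (ed ?f) + 2 \<le> load K (trees s) (ed ?e)"
    using imp by (auto simp: improving_def ld_def)
  then have pot: "potential ?s < potential s"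
    unfolding potential_def tr using e f by (intro move_decreases_potential[where Tr = "trees s", OF b(2) eT]) auto
  have ld: "load K (trees ?s) = (if ed ?f \<in> trees s i then (load K (trees s))(ed ?e := load K (trees s) (ed ?e) - 1)
     else (load K (trees s))(ed ?e := load K (trees s) (ed ?e) - 1, ed ?f := load K (trees s) (ed ?f) + 1))"
    unfolding tr by (rule load_after_move[where Tr = "trees s", OF b(2) eT])
  have pos: "0 < ld s ?e" unfolding ld_def by (rule load_pos[where Tr = "trees s", OF b(2) eT])
  have cl: "s ''cl'' k + ld s k = K" if "k < m" for k using F that by (simp add: family_inv_def)
  have C1: "s ''C'' q \<le> 1" for q using F by (simp add: family_inv_def)
  have Ce: "s ''C'' (i * m + ?e) = 0" using imp by (simp add: improving_def)
  have cl': "?s ''cl'' = ((s ''cl'')(?f := s ''cl'' ?f - s ''C'' (i * m + ?f)))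
      (?e := ((s ''cl'')(?f := s ''cl'' ?f - s ''C'' (i * m + ?f))) ?e + 1)"
    using b by (simp add: update_com_def)
  have "?s ''cl'' k + ld ?s k = K" if k: "k < m" for k
  proof (cases "s ''C'' (i * m + ?f) = 0")
    case True
    then have "ld ?s k = (if k = ?e then ld s ?e - 1 else ld s k)"
      using ld k e f by (simp add: ld_def mem_trees ed_eq_iff)
    then show ?thesis using True cl[OF k] pos by (auto simp: cl')
  next
    case False
    then have one: "s ''C'' (i * m + ?f) = 1" using C1[of "i * m + ?f"] by simp
    then have ne: "?e \<noteq> ?f" using Ce by auto
    have l: "ld ?s k = (if k = ?f then ld s ?f + 1 else if k = ?e then ld s ?e - 1 else ld s k)" if "k < m" for k
      using ld that e f False by (simp add: ld_def mem_trees ed_eq_iff)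
    \<comment> \<open>The truncated decrement of \<open>cl\<close> is exact: after the move
      \<open>f\<close> has load \<open>ld s ?f + 1\<close>, at most \<open>K\<close>, so its entry
      was positive before.\<close>
    have "ld s ?f + 1 \<le> K" using l[OF f] load_le[of K "trees ?s" "ed ?f"] by (simp add: ld_def)
    then have "1 \<le> s ''cl'' ?f" using cl[OF f] by linarith
    then show ?thesis using one ne cl[OF k] pos l[OF k] by (auto simp: cl')
  qed
  moreover have "graph_connected {..<n} (trees ?s i')" if "i' < K" for i'
    using F that imp unfolding tr by (auto simp: family_inv_def improving_def)
  moreover have "?s ''C'' q \<le> 1" for q using C1 by (simp add: update_com_def)
  ultimately show ?thesis using pot by (simp add: family_inv_def)
qed

lemma position_bound:
  assumes "scan_inv s" shows "position s < K * m * m + m * m"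
proof -
  obtain i where i: "i \<le> K" "s ''base'' 0 = i * m" "s ''e'' 0 < m" "s ''f'' 0 < m"
    using assms by (auto simp: scan_inv_def)
  have "position s < (s ''base'' 0 + s ''e'' 0) * m + m" using i by (simp add: position_def)
  also have "\<dots> = (s ''base'' 0 + s ''e'' 0 + 1) * m" by simp
  also have "\<dots> \<le> (K * m + m) * m"
  proof (rule mult_right_mono)
    have "i * m \<le> K * m" using i(1) by (rule mult_right_mono) simp
    then show "s ''base'' 0 + s ''e'' 0 + 1 \<le> K * m + m" using i(2,3) by linarith
  qed simp
  finally show ?thesis by (simp add: algebra_simps)
qed

text \<open>The only triple newly passed is the one that was just tested.\<close>

lemma advance_step:
  assumes S: "scan_inv s" and b: "s ''base'' 0 = i * m" "i < K" and m: "s ''m'' 0 = m"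
    and imp: "\<not> improving s i (s ''e'' 0) (s ''f'' 0)"
  shows "scan_inv (effect advance_com s) \<and> position (effect advance_com s) = position s + 1"
proof -
  let ?s = "effect advance_com s"
  have ef: "s ''e'' 0 < m" "s ''f'' 0 < m" using S by (auto simp: scan_inv_def)
  have pos: "position ?s = position s + 1" and bd: "?s ''e'' 0 < m \<and> ?s ''f'' 0 < m \<and> (\<exists>i\<le>K. ?s ''base'' 0 = i * m)"
  proof -
    consider "s ''f'' 0 + 1 < m" | "s ''f'' 0 + 1 = m" "s ''e'' 0 + 1 < m"
      | "s ''f'' 0 + 1 = m" "s ''e'' 0 + 1 = m" using ef by linarith
    then have "position ?s = position s + 1 \<and> ?s ''e'' 0 < m \<and> ?s ''f'' 0 < m \<and> (\<exists>i\<le>K. ?s ''base'' 0 = i * m)"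
    proof cases
      case 1
      then have "?s ''f'' 0 = s ''f'' 0 + 1" "?s ''e'' 0 = s ''e'' 0" "?s ''base'' 0 = s ''base'' 0"
        using m by (simp_all add: advance_com_def)
      then show ?thesis using 1 ef b by (auto simp: position_def intro!: exI[of _ i])
    next
      case 2
      then have v: "?s ''f'' 0 = 0" "?s ''e'' 0 = s ''e'' 0 + 1" "?s ''base'' 0 = s ''base'' 0"
        using m by (simp_all add: advance_com_def)
      have "position ?s = (s ''base'' 0 + s ''e'' 0) * m + m" using v by (simp add: position_def)
      also have "\<dots> = position s + 1" using 2 by (simp add: position_def)
      finally show ?thesis using v 2 ef b by (auto intro!: exI[of _ i])
    next
      \<comment> \<open>\<open>base\<close> gains \<open>m\<close> while \<open>e\<close> falls from
        \<open>m - 1\<close> to 0, so \<open>base + e\<close> grows by 1 and positions stay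
        consecutive across rows.\<close>
      case 3
      then have v: "?s ''f'' 0 = 0" "?s ''e'' 0 = 0" "?s ''base'' 0 = s ''base'' 0 + m"
        using m by (simp_all add: advance_com_def)
      have "position ?s = (s ''base'' 0 + (s ''e'' 0 + 1)) * m" using v 3 by (simp add: position_def)
      also have "\<dots> = (s ''base'' 0 + s ''e'' 0) * m + (s ''f'' 0 + 1)" using 3(1) by (simp add: algebra_simps)
      also have "\<dots> = position s + 1" by (simp add: position_def)
      finally show ?thesis using v m_pos b by (auto intro!: exI[of _ "Suc i"])
    qed
    then show "position ?s = position s + 1" "?s ''e'' 0 < m \<and> ?s ''f'' 0 < m \<and> (\<exists>i\<le>K. ?s ''base'' 0 = i * m)"
      by blast+
  qed
  have C: "?s ''C'' = s ''C''" by (simp add: advance_com_def)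
  have "\<not> improving ?s i' e' f'"
    if "i' < K" "e' < m" "f' < m" "(i' * m + e') * m + f' < position ?s" for i' e' f'
  proof (cases "(i' * m + e') * m + f' = position s")
    case True
    then have "i' * m + e' = i * m + s ''e'' 0 \<and> f' = s ''f'' 0"
      using flat_index_eq[of "i' * m + e'" m f' "i * m + s ''e'' 0" "s ''f'' 0"] that ef b(1)
      by (simp add: position_def)
    then have "i' = i \<and> e' = s ''e'' 0 \<and> f' = s ''f'' 0"
      using flat_index_eq[of i' m e' i "s ''e'' 0"] that ef by simp
    then show ?thesis using imp search_state_cong(3)[of ?s s, OF C] by simp
  next
    case False
    then have "(i' * m + e') * m + f' < position s" using that pos by linarith
    then show ?thesis using S that search_state_cong(3)[of ?s s, OF C] by (simp add: scan_inv_def)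
  qed
  then show ?thesis using pos bd by (simp add: scan_inv_def)
qed

text \<open>As \<open>cl\<close> and \<open>ld\<close> add up to \<open>K\<close>, the test of the
  program amounts to \<open>improving\<close>; each branch then lowers the lexicographic
  measure.\<close>

lemma step_correct:
  assumes inp: "is_input s" and F: "family_inv s" and S: "scan_inv s" and b: "s ''base'' 0 < K * m"
    and cnt: "n \<le> s ''cnt'' 0 \<longleftrightarrow> graph_connected {..<n} (active_edges s)"
  defines "s' \<equiv> effect step_com s"
  shows "family_inv s' \<and> scan_inv s' \<and> search_measure s' < search_measure s"
proof -
  obtain i where i: "s ''base'' 0 = i * m" using S by (auto simp: scan_inv_def)
  then have iK: "i < K" using b by simp
  have ef: "s ''e'' 0 < m" "s ''f'' 0 < m" using S by (auto simp: scan_inv_def)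
  have cl: "s ''cl'' (s ''e'' 0) + ld s (s ''e'' 0) = K" "s ''cl'' (s ''f'' 0) + ld s (s ''f'' 0) = K"
    using F ef by (auto simp: family_inv_def)
  have nm: "s ''n'' 0 = n" "s ''m'' 0 = m" using inp by (auto simp: is_input_def)
  have test: "bval (Conj candidate (Neg (Less (var ''cnt'') (var ''n'')))) s \<longleftrightarrow> improving s i (s ''e'' 0) (s ''f'' 0)"
  proof -
    have "bval candidate s \<longleftrightarrow> s ''C'' (i * m + s ''e'' 0) = 0 \<and>
        (s ''e'' 0 = s ''f'' 0 \<or> s ''cl'' (s ''e'' 0) + 2 \<le> s ''cl'' (s ''f'' 0))"
      using i by (auto simp: candidate_def)
    moreover have "s ''cl'' (s ''e'' 0) + 2 \<le> s ''cl'' (s ''f'' 0) \<longleftrightarrow> ld s (s ''f'' 0) + 2 \<le> ld s (s ''e'' 0)"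
      using cl by linarith
    moreover have "bval (Neg (Less (var ''cnt'') (var ''n''))) s \<longleftrightarrow>
        graph_connected {..<n} (insert (ed (s ''f'' 0)) (trees s i) - {ed (s ''e'' 0)})"
      unfolding active_edges_move[of s i, OF i ef, symmetric] cnt[symmetric] by (simp add: nm(1) not_less)
    ultimately show ?thesis unfolding improving_def by (simp only: bval.simps(3) conj_assoc)
  qed
  have pb: "position s < K * m * m + m * m" by (rule position_bound[OF S])
  show ?thesis
  proof (cases "improving s i (s ''e'' 0) (s ''f'' 0)")
    case True
    then have s': "s' = effect update_com s" using test by (simp add: s'_def step_com_def)
    have zero: "s' ''base'' 0 = 0" "s' ''e'' 0 = 0" "s' ''f'' 0 = 0"
      by (simp_all add: s' update_com_def)
    then have p0: "position s' = 0" by (simp add: position_def)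
    then have "scan_inv s'" using zero m_pos by (auto simp: scan_inv_def)
    moreover have u: "family_inv s'" "potential s' < potential s"
      using update_step[of s i, OF F i iK ef True] by (auto simp: s')
    moreover have "search_measure s' < search_measure s"
    proof -
      let ?R = "K * m * m + m * m + 1"
      have "potential s' * ?R + ?R \<le> potential s * ?R"
        using mult_right_mono[of "potential s' + 1" "potential s" ?R] u(2) by simp
      then show ?thesis unfolding search_measure_def p0 by linarith
    qed
    ultimately show ?thesis by simp
  next
    case False
    then have s': "s' = effect advance_com s" using test by (auto simp: s'_def step_com_def)
    have C: "s' ''C'' = s ''C''" "s' ''cl'' = s ''cl''" by (simp_all add: s' advance_com_def)
    have a: "scan_inv s'" "position s' = position s + 1"
      using advance_step[of s i, OF S i iK nm(2) False] by (auto simp: s')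
    moreover have "family_inv s'" using F family_inv_cong[of s' s, OF C] by simp
    moreover have "search_measure s' < search_measure s"
      using a(2) pb search_state_cong(4)[of s' s, OF C(1)] by (simp add: search_measure_def)
    ultimately show ?thesis by simp
  qed
qed

text \<open>An upper bound for \<open>search_measure\<close>, with the potential estimated by
  \<open>potential_le\<close>.\<close>

definition search_bound :: nat where
  "search_bound = m * K\<^sup>2 * (K * m * m + m * m + 1) + (K * m * m + m * m)"

lemma scan_inv_cong:
  assumes "\<forall>w. w \<notin> {''mark'', ''k'', ''cnt''} \<longrightarrow> s' w = s w"
  shows "family_inv s' = family_inv s" "scan_inv s' = scan_inv s" "search_measure s' = search_measure s"
    "is_input s' = is_input s" "active_edges s' = active_edges s"
proof -
  have eq: "s' ''C'' = s ''C''" "s' ''cl'' = s ''cl''" "s' ''base'' = s ''base''" "s' ''e'' = s ''e''"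
    "s' ''f'' = s ''f''" "s' ''n'' = s ''n''" "s' ''m'' = s ''m''" "s' ''src'' = s ''src''" "s' ''dst'' = s ''dst''"
    using assms by simp_all
  show "family_inv s' = family_inv s" by (rule family_inv_cong[of s' s, OF eq(1,2)])
  show "scan_inv s' = scan_inv s" "search_measure s' = search_measure s"
    using search_state_cong[of s' s, OF eq(1)] eq by (simp_all add: scan_inv_def search_measure_def position_def)
  show "is_input s' = is_input s" "active_edges s' = active_edges s"
    using eq by (simp_all add: is_input_def active_edges_def)
qed

text \<open>Once \<open>base\<close> has reached \<open>K * m\<close>, every triple with
  \<open>i < K\<close> has a smaller position, so by \<open>scan_inv\<close> none is
  improving.\<close>

lemma search_runs:
  assumes inp: "is_input s" and F: "family_inv s" and S: "scan_inv s" and lim: "s ''lim'' 0 = K * m"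
  shows "runs search_com s ((search_bound + 1) * (2000 * (n + 1) * (m + 1)))
    (\<lambda>s'. family_inv s' \<and> locally_optimal {..<n} E K (trees s') \<and>
       (\<forall>w. w \<notin> {''mark'', ''k'', ''cnt'', ''C'', ''cl'', ''base'', ''e'', ''f''} \<longrightarrow> s' w = s w))"
proof -
  let ?b = "Less (var ''base'') (var ''lim'')" and ?c = "Seq check_com step_com"
  let ?Tb = "1000 * (n + 1) * (m + 1) + ccost step_com"
  have wr: "written ?c \<subseteq> {''mark'', ''k'', ''cnt'', ''C'', ''cl'', ''base'', ''e'', ''f''}"
    by (simp add: check_com_def step_com_def reset_body_def reach_init_def reach_body_def
        update_com_def advance_com_def)
  have "runs (While ?b ?c) s ((search_bound + 1) * (1 + bcost ?b + ?Tb))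
    (\<lambda>s'. (family_inv s' \<and> scan_inv s') \<and> \<not> bval ?b s' \<and> (\<forall>x. x \<notin> written ?c \<longrightarrow> s' x = s x))"
  proof (rule runs_While[where \<mu> = search_measure])
    fix s1 assume I: "family_inv s1 \<and> scan_inv s1" and fr: "\<forall>x. x \<notin> written ?c \<longrightarrow> s1 x = s x"
      and b: "bval ?b s1"
    have keep: "s1 x = s x" if "x \<notin> {''mark'', ''k'', ''cnt'', ''C'', ''cl'', ''base'', ''e'', ''f''}" for x
      using fr wr that by (meson subsetD)
    have inp1: "is_input s1" using inp by (simp add: is_input_def keep)
    have base: "s1 ''base'' 0 < K * m" using b lim by (simp add: keep)
    show "runs ?c s1 ?Tb (\<lambda>s''. (family_inv s'' \<and> scan_inv s'') \<and> search_measure s'' < search_measure s1)"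
    proof (rule runs_Seq[OF check_runs[OF inp1]])
      fix s2 assume s2: "(n \<le> s2 ''cnt'' 0 \<longleftrightarrow> graph_connected {..<n} (active_edges s1)) \<and>
         (\<forall>w. w \<notin> {''mark'', ''k'', ''cnt''} \<longrightarrow> s2 w = s1 w)"
      note cong = scan_inv_cong[of s2 s1, OF conjunct2[OF s2]]
      have "s2 ''base'' = s1 ''base''" using s2 by simp
      then have "family_inv (effect step_com s2) \<and> scan_inv (effect step_com s2) \<and>
          search_measure (effect step_com s2) < search_measure s2"
        using s2 I inp1 base by (intro step_correct) (simp_all add: cong)
      then show "runs step_com s2 (ccost step_com)
          (\<lambda>s''. (family_inv s'' \<and> scan_inv s'') \<and> search_measure s'' < search_measure s1)"
        by (intro runs_loop_free) (simp_all add: cong step_com_def update_com_def advance_com_def)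
    qed
  next
    show "family_inv s \<and> scan_inv s" using F S by simp
    show "search_measure s \<le> search_bound"
      unfolding search_measure_def search_bound_def
      by (intro add_mono mult_right_mono potential_le) auto
  qed
  then show ?thesis unfolding search_com_def
  proof (rule runs_mono)
    show "(search_bound + 1) * (1 + bcost ?b + ?Tb) \<le> (search_bound + 1) * (2000 * (n + 1) * (m + 1))"
    proof (rule mult_left_mono)
      have "1 + bcost ?b + ccost step_com \<le> 1000 * 1"
        by (simp add: step_com_def candidate_def update_com_def advance_com_def eqb_def orb_def)
      also have "\<dots> \<le> 1000 * ((n + 1) * (m + 1))" by (rule mult_left_mono) auto
      finally show "1 + bcost ?b + ?Tb \<le> 2000 * (n + 1) * (m + 1)" by linarith
    qed simp
    fix s' assume a: "(family_inv s' \<and> scan_inv s') \<and> \<not> bval ?b s' \<and> (\<forall>x. x \<notin> written ?c \<longrightarrow> s' x = s x)"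
    have keep: "s' x = s x" if "x \<notin> {''mark'', ''k'', ''cnt'', ''C'', ''cl'', ''base'', ''e'', ''f''}" for x
      using a wr that by (meson subsetD)
    have "\<not> s' ''base'' 0 < K * m" using a lim by (simp add: keep)
    have imp: "\<not> improving s' i e f" if "i < K" "e < m" "f < m" for i e f
    proof -
      have "(i * m + e) * m + f < (i * m + e) * m + m" using that by simp
      also have "\<dots> = (i * m + e + 1) * m" by simp
      also have "\<dots> \<le> (i * m + m) * m" using that by (intro mult_right_mono) auto
      also have "\<dots> = (Suc i * m) * m" by (simp add: algebra_simps)
      also have "\<dots> \<le> (K * m) * m" using that by (intro mult_right_mono) auto
      also have "\<dots> \<le> (s' ''base'' 0) * m" using \<open>\<not> s' ''base'' 0 < K * m\<close> by (intro mult_right_mono) auto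
      also have "\<dots> \<le> position s'" by (simp add: position_def add_mult_distrib)
      finally show ?thesis using a that by (simp add: scan_inv_def)
    qed
    have "locally_optimal {..<n} E K (trees s')"
      unfolding locally_optimal_def
    proof (intro conjI allI impI ballI)
      fix i assume "i < K"
      then show "trees s' i \<subseteq> E" "graph_connected {..<n} (trees s' i)"
        using a trees_subset by (auto simp: family_inv_def)
    next
      fix i g h assume i: "i < K" and g: "g \<in> trees s' i" and h: "h \<in> E"
        and l: "h = g \<or> load K (trees s') h + 2 \<le> load K (trees s') g"
      obtain e where e: "g = ed e" "e < m" "s' ''C'' (i * m + e) = 0" using g by (auto simp: trees_def)
      obtain f where f: "h = ed f" "f < m" using h by auto
      have "e = f \<or> ld s' f + 2 \<le> ld s' e" using l e f ed_eq_iff by (auto simp: ld_def)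
      then show "\<not> graph_connected {..<n} (insert h (trees s' i) - {g})"
        using imp[OF i e(2) f(2)] e f by (simp add: improving_def)
    qed
    then show "family_inv s' \<and> locally_optimal {..<n} E K (trees s') \<and>
       (\<forall>w. w \<notin> {''mark'', ''k'', ''cnt'', ''C'', ''cl'', ''base'', ''e'', ''f''} \<longrightarrow> s' w = s w)"
      using a keep by blast
  qed
qed

end

section \<open>The program\<close>

text \<open>The largest entry of \<open>cl\<close> belongs to the smallest load.\<close>

definition max_body :: com where
  "max_body = Seq (Cond (Less (var ''h'') (Cell ''cl'' (var ''k''))) (set_var ''h'' (Cell ''cl'' (var ''k''))) Skip)
     (incr ''k'')"

text \<open>Lowers \<open>h\<close> as long as some edge lies one level below, starting over each
  time. At the end no entry of \<open>cl\<close> lies one below \<open>h\<close>, which is a gap in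
  the loads just above \<open>K - h\<close>.\<close>

definition gap_body :: com where
  "gap_body = Cond (eqb (Add (Cell ''cl'' (var ''k'')) (Lit 1)) (var ''h''))
     (Seq (set_var ''h'' (Monus (var ''h'') (Lit 1))) (set_var ''k'' (Lit 0)))
     (incr ''k'')"

text \<open>Row 0 of \<open>C\<close> starts at cell 0, so \<open>num\<close> counts the edges of
  member 0 in the level set and \<open>den\<close> all edges of that set.\<close>

definition output_body :: com where
  "output_body = Seq (Assign ''wden'' (var ''k'') (Lit 1))
     (Seq (Cond (Less (Cell ''cl'' (var ''k'')) (var ''h''))
        (Assign ''wnum'' (var ''k'') (Lit 0))
        (Seq (Assign ''wnum'' (var ''k'') (Lit 1))
        (Seq (incr ''den'') (set_var ''num'' (Add (var ''num'') (Monus (Lit 1) (Cell ''C'' (var ''k''))))))))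
     (incr ''k''))"

definition scan_edges :: "com \<Rightarrow> com" where
  "scan_edges c = Seq (set_var ''k'' (Lit 0)) (While (Less (var ''k'') (var ''m'')) c)"

text \<open>The measure is left open instead of being \<open>m - k\<close>, because
  \<open>gap_body\<close> resets \<open>k\<close>.\<close>

lemma runs_scan_edges:
  assumes lf: "loop_free c" and m: "s ''m'' 0 = m" and wr: "''m'' \<notin> written c" and cost: "ccost c \<le> 100"
    and init: "\<And>s1. s1 ''k'' 0 = 0 \<Longrightarrow> \<forall>x. x \<noteq> ''k'' \<longrightarrow> s1 x = s x \<Longrightarrow> I s1 \<and> \<mu> s1 \<le> M"
    and step: "\<And>s1. I s1 \<Longrightarrow> s1 ''k'' 0 < m \<Longrightarrow> \<forall>x. x \<notin> written c \<union> {''k''} \<longrightarrow> s1 x = s x \<Longrightarrow>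
      I (effect c s1) \<and> (\<mu> (effect c s1) :: nat) < \<mu> s1"
  shows "runs (scan_edges c) s (200 * (M + 1))
    (\<lambda>s'. I s' \<and> m \<le> s' ''k'' 0 \<and> (\<forall>x. x \<notin> written c \<union> {''k''} \<longrightarrow> s' x = s x))"
proof -
  let ?b = "Less (var ''k'') (var ''m'')"
  let ?P = "\<lambda>s1. s1 ''k'' 0 = 0 \<and> (\<forall>x. x \<noteq> ''k'' \<longrightarrow> s1 x = s x)"
  have 1: "runs (set_var ''k'' (Lit 0)) s (ccost (set_var ''k'' (Lit 0))) ?P"
    by (rule runs_loop_free) auto
  have 2: "runs (While ?b c) s1 ((M + 1) * (1 + bcost ?b + ccost c))
     (\<lambda>s'. I s' \<and> m \<le> s' ''k'' 0 \<and> (\<forall>x. x \<notin> written c \<union> {''k''} \<longrightarrow> s' x = s x))" if s1: "?P s1" for s1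
  proof (rule runs_mono)
    show "runs (While ?b c) s1 ((M + 1) * (1 + bcost ?b + ccost c))
       (\<lambda>s'. I s' \<and> \<not> bval ?b s' \<and> (\<forall>x. x \<notin> written c \<longrightarrow> s' x = s1 x))"
    proof (rule runs_While_loop_free[OF lf, where \<mu> = \<mu>])
      fix s2 assume I: "I s2" and fr: "\<forall>x. x \<notin> written c \<longrightarrow> s2 x = s1 x" and b: "bval ?b s2"
      have fr': "\<forall>x. x \<notin> written c \<union> {''k''} \<longrightarrow> s2 x = s x" using fr s1 by simp
      then have "s2 ''m'' 0 = m" using m wr by simp
      then show "I (effect c s2) \<and> \<mu> (effect c s2) < \<mu> s2" using step[OF I _ fr'] b by simp
    qed (use init s1 in auto)
    fix s' assume a: "I s' \<and> \<not> bval ?b s' \<and> (\<forall>x. x \<notin> written c \<longrightarrow> s' x = s1 x)"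
    then have fr': "\<forall>x. x \<notin> written c \<union> {''k''} \<longrightarrow> s' x = s x" using s1 by simp
    then have "s' ''m'' 0 = m" using m wr by simp
    then show "I s' \<and> m \<le> s' ''k'' 0 \<and> (\<forall>x. x \<notin> written c \<union> {''k''} \<longrightarrow> s' x = s x)" using a fr' by simp
  qed simp
  have T: "ccost (set_var ''k'' (Lit 0)) + (M + 1) * (1 + bcost ?b + ccost c) \<le> 200 * (M + 1)"
  proof -
    have "(M + 1) * (1 + bcost ?b + ccost c) \<le> (M + 1) * 150"
      using cost by (intro mult_left_mono) auto
    then show ?thesis by simp
  qed
  show ?thesis unfolding scan_edges_def
    by (rule runs_mono[OF runs_Seq[OF 1 2] T])
qed

context edge_list
begin

section \<open>Finding a load gap and writing the output\<close>

lemma max_runs: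
  assumes m: "s ''m'' 0 = m" and h: "s ''h'' 0 = 0"
  shows "runs (scan_edges max_body) s (200 * (m + 1))
    (\<lambda>s'. (\<forall>k<m. s ''cl'' k \<le> s' ''h'' 0) \<and> (\<exists>k<m. s ''cl'' k = s' ''h'' 0) \<and>
       (\<forall>x. x \<notin> {''h'', ''k''} \<longrightarrow> s' x = s x))"
proof (rule runs_mono)
  let ?I = "\<lambda>s'. s' ''k'' 0 \<le> m \<and> (\<forall>k<s' ''k'' 0. s ''cl'' k \<le> s' ''h'' 0) \<and>
     (s' ''h'' 0 = 0 \<or> (\<exists>k<m. s ''cl'' k = s' ''h'' 0))"
  show "runs (scan_edges max_body) s (200 * (m + 1)) (\<lambda>s'. ?I s' \<and> m \<le> s' ''k'' 0 \<and>
      (\<forall>x. x \<notin> written max_body \<union> {''k''} \<longrightarrow> s' x = s x))"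
  proof (rule runs_scan_edges[where \<mu> = "\<lambda>s'. m - s' ''k'' 0"])
    fix s1 assume I: "?I s1" and k: "s1 ''k'' 0 < m" and fr: "\<forall>x. x \<notin> written max_body \<union> {''k''} \<longrightarrow> s1 x = s x"
    have cl: "s1 ''cl'' = s ''cl''" using fr by (simp add: max_body_def)
    define k h where "k = s1 ''k'' 0" and "h = s1 ''h'' 0"
    have v: "effect max_body s1 ''k'' 0 = k + 1" "effect max_body s1 ''h'' 0 = max h (s ''cl'' k)"
      by (auto simp: max_body_def cl k_def h_def)
    have old: "\<forall>l<k. s ''cl'' l \<le> h" "h = 0 \<or> (\<exists>l<m. s ''cl'' l = h)" "k < m"
      using I k by (auto simp: k_def h_def)
    have "\<forall>l<k + 1. s ''cl'' l \<le> max h (s ''cl'' k)" using old(1) by (auto simp: less_Suc_eq max.coboundedI1)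
    moreover have "max h (s ''cl'' k) = 0 \<or> (\<exists>l<m. s ''cl'' l = max h (s ''cl'' k))"
      using old(2,3) by (auto simp: max_def)
    ultimately show "?I (effect max_body s1) \<and> m - effect max_body s1 ''k'' 0 < m - s1 ''k'' 0"
      unfolding v k_def[symmetric] using old(3) by simp
  qed (use m h in \<open>auto simp: max_body_def\<close>)
  fix s' assume a: "?I s' \<and> m \<le> s' ''k'' 0 \<and> (\<forall>x. x \<notin> written max_body \<union> {''k''} \<longrightarrow> s' x = s x)"
  then have all: "\<forall>k<m. s ''cl'' k \<le> s' ''h'' 0" by auto
  have "\<exists>k<m. s ''cl'' k = s' ''h'' 0"
  proof (cases "s' ''h'' 0 = 0")
    \<comment> \<open>With maximum 0 all entries are 0, and some edge exists because
      \<open>m\<close> is positive.\<close>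
    case True
    then show ?thesis using all m_pos by auto
  next
    case False
    then show ?thesis using a by simp
  qed
  then show "(\<forall>k<m. s ''cl'' k \<le> s' ''h'' 0) \<and> (\<exists>k<m. s ''cl'' k = s' ''h'' 0) \<and>
       (\<forall>x. x \<notin> {''h'', ''k''} \<longrightarrow> s' x = s x)" using all a by (simp add: max_body_def)
qed simp

text \<open>All levels from \<open>h\<close> up to \<open>h0\<close> stay occupied. Each restart
  lowers \<open>h\<close>, which is at most \<open>K\<close>, so the lexicographic measure yields
  the factor \<open>K\<close> in the time.\<close>

lemma gap_runs:
  assumes m: "s ''m'' 0 = m" and h: "s ''h'' 0 = h0" and K: "h0 \<le> K" and ex: "\<exists>k<m. s ''cl'' k = h0"
  shows "runs (scan_edges gap_body) s (200 * (K * (m + 1) + m + 1))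
    (\<lambda>s'. s' ''h'' 0 \<le> h0 \<and> (\<forall>x. s' ''h'' 0 \<le> x \<and> x \<le> h0 \<longrightarrow> (\<exists>k<m. s ''cl'' k = x)) \<and>
       (\<forall>k<m. s ''cl'' k + 1 \<noteq> s' ''h'' 0) \<and> (\<forall>x. x \<notin> {''h'', ''k''} \<longrightarrow> s' x = s x))"
proof (rule runs_mono)
  let ?I = "\<lambda>s'. s' ''k'' 0 \<le> m \<and> s' ''h'' 0 \<le> h0 \<and>
     (\<forall>x. s' ''h'' 0 \<le> x \<and> x \<le> h0 \<longrightarrow> (\<exists>k<m. s ''cl'' k = x)) \<and>
     (\<forall>k<s' ''k'' 0. s ''cl'' k + 1 \<noteq> s' ''h'' 0)"
  let ?\<mu> = "\<lambda>s'. s' ''h'' 0 * (m + 1) + (m - s' ''k'' 0)"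
  show "runs (scan_edges gap_body) s (200 * (K * (m + 1) + m + 1)) (\<lambda>s'. ?I s' \<and> m \<le> s' ''k'' 0 \<and>
      (\<forall>x. x \<notin> written gap_body \<union> {''k''} \<longrightarrow> s' x = s x))"
  proof (rule runs_scan_edges[where \<mu> = ?\<mu>])
    fix s1 assume I: "?I s1" and k: "s1 ''k'' 0 < m" and fr: "\<forall>x. x \<notin> written gap_body \<union> {''k''} \<longrightarrow> s1 x = s x"
    have cl: "s1 ''cl'' = s ''cl''" using fr by (simp add: gap_body_def)
    define k h where "k = s1 ''k'' 0" and "h = s1 ''h'' 0"
    have old: "k < m" "h \<le> h0" "\<forall>x. h \<le> x \<and> x \<le> h0 \<longrightarrow> (\<exists>k<m. s ''cl'' k = x)"
       "\<forall>l<k. s ''cl'' l + 1 \<noteq> h" using I k by (auto simp: k_def h_def)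
    show "?I (effect gap_body s1) \<and> ?\<mu> (effect gap_body s1) < ?\<mu> s1"
    proof (cases "s ''cl'' k + 1 = h")
      case True
      have v: "effect gap_body s1 ''k'' 0 = 0" "effect gap_body s1 ''h'' 0 = s ''cl'' k"
        using True by (auto simp: gap_body_def cl k_def h_def)
      have "\<exists>l<m. s ''cl'' l = x" if "s ''cl'' k \<le> x" "x \<le> h0" for x
      proof (cases "x = s ''cl'' k")
        case True
        then show ?thesis using old(1) by blast
      next
        case False
        then have "h \<le> x" using that \<open>s ''cl'' k + 1 = h\<close> by linarith
        then show ?thesis using old(3) that by blast
      qed
      moreover have "s ''cl'' k \<le> h0" using True old(2) by linarith
      ultimately show ?thesis unfolding v k_def[symmetric] h_def[symmetric] True[symmetric] by auto
    next
      case False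
      have v: "effect gap_body s1 ''k'' 0 = k + 1" "effect gap_body s1 ''h'' 0 = h"
        using False by (auto simp: gap_body_def cl k_def h_def)
      have "\<forall>l<k + 1. s ''cl'' l + 1 \<noteq> h" using old(4) False by (auto simp: less_Suc_eq)
      then show ?thesis unfolding v k_def[symmetric] h_def[symmetric] using old(1-3) by auto
    qed
  next
    fix s1 assume s1: "s1 ''k'' 0 = 0" "\<forall>x. x \<noteq> ''k'' \<longrightarrow> s1 x = s x"
    then have hh: "s1 ''h'' 0 = h0" using h by simp
    have "?\<mu> s1 \<le> K * (m + 1) + m" unfolding hh using K by (intro add_mono mult_right_mono) auto
    then show "?I s1 \<and> ?\<mu> s1 \<le> K * (m + 1) + m" unfolding hh s1(1) using ex by auto
  qed (use m in \<open>auto simp: gap_body_def eqb_def\<close>)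
  fix s' assume a: "?I s' \<and> m \<le> s' ''k'' 0 \<and> (\<forall>x. x \<notin> written gap_body \<union> {''k''} \<longrightarrow> s' x = s x)"
  then have "\<forall>k<m. s ''cl'' k + 1 \<noteq> s' ''h'' 0" by auto
  then show "s' ''h'' 0 \<le> h0 \<and> (\<forall>x. s' ''h'' 0 \<le> x \<and> x \<le> h0 \<longrightarrow> (\<exists>k<m. s ''cl'' k = x)) \<and>
       (\<forall>k<m. s ''cl'' k + 1 \<noteq> s' ''h'' 0) \<and> (\<forall>x. x \<notin> {''h'', ''k''} \<longrightarrow> s' x = s x)"
    using a by (simp add: gap_body_def)
qed simp

lemma output_runs:
  assumes m: "s ''m'' 0 = m" and z: "s ''num'' 0 = 0" "s ''den'' 0 = 0" and C: "\<forall>q. s ''C'' q \<le> 1"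
  defines "Q \<equiv> \<lambda>k s'. s' ''den'' 0 = card {l. l < k \<and> s ''h'' 0 \<le> s ''cl'' l} \<and>
      s' ''num'' 0 = card {l. l < k \<and> s ''h'' 0 \<le> s ''cl'' l \<and> s ''C'' l = 0} \<and>
      (\<forall>l<k. s' ''wden'' l = 1 \<and> s' ''wnum'' l = (if s ''h'' 0 \<le> s ''cl'' l then 1 else 0))"
  shows "runs (scan_edges output_body) s (200 * (m + 1)) (Q m)"
proof (rule runs_mono)
  let ?I = "\<lambda>s'. s' ''k'' 0 \<le> m \<and> Q (s' ''k'' 0) s'"
  show "runs (scan_edges output_body) s (200 * (m + 1)) (\<lambda>s'. ?I s' \<and> m \<le> s' ''k'' 0 \<and>
      (\<forall>x. x \<notin> written output_body \<union> {''k''} \<longrightarrow> s' x = s x))"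
  proof (rule runs_scan_edges[where \<mu> = "\<lambda>s'. m - s' ''k'' 0"])
    fix s1 assume I: "?I s1" and k: "s1 ''k'' 0 < m" and fr: "\<forall>x. x \<notin> written output_body \<union> {''k''} \<longrightarrow> s1 x = s x"
    have eq: "s1 ''cl'' = s ''cl''" "s1 ''C'' = s ''C''" "s1 ''h'' = s ''h''" using fr by (simp_all add: output_body_def)
    define k where "k = s1 ''k'' 0"
    define s2 where "s2 = effect output_body s1"
    let ?L = "s ''h'' 0 \<le> s ''cl'' k"
    have v: "s2 ''k'' 0 = k + 1" "s2 ''den'' 0 = s1 ''den'' 0 + (if ?L then 1 else 0)"
      "s2 ''num'' 0 = s1 ''num'' 0 + (if ?L \<and> s ''C'' k = 0 then 1 else 0)"
      "s2 ''wden'' l = (if l = k then 1 else s1 ''wden'' l)"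
      "s2 ''wnum'' l = (if l = k then (if ?L then 1 else 0) else s1 ''wnum'' l)" for l
      using C[rule_format, of k] by (auto simp: s2_def output_body_def eq k_def)
    have ins: "{l. l < k + 1 \<and> P l} = (if P k then insert k {l. l < k \<and> P l} else {l. l < k \<and> P l})" for P
      by (auto simp: less_Suc_eq)
    have old: "Q k s1" using I by (simp add: k_def)
    have "Q (k + 1) s2"
      using old unfolding Q_def v ins by (auto simp: less_Suc_eq)
    then show "?I (effect output_body s1) \<and> m - effect output_body s1 ''k'' 0 < m - s1 ''k'' 0"
      unfolding s2_def[symmetric] v(1) k_def[symmetric] using k by (simp add: k_def)
  qed (use m z in \<open>auto simp: output_body_def Q_def\<close>)
  fix s' assume "?I s' \<and> m \<le> s' ''k'' 0 \<and> (\<forall>x. x \<notin> written output_body \<union> {''k''} \<longrightarrow> s' x = s x)"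
  then show "Q m s'" by (metis le_antisym)
qed simp

text \<open>Reflecting levels \<open>x\<close> to \<open>K - x\<close> turns the occupied levels
  from \<open>h\<close> to \<open>h0\<close> into the loads from the minimum \<open>K - h0\<close>
  up to \<open>K - h\<close>, to which the pigeonhole bound applies.\<close>

lemma threshold_load_gap:
  assumes F: "family_inv s" and h: "h \<le> h0" "h0 \<le> K" and mx: "\<forall>k<m. s ''cl'' k \<le> h0"
    and ex: "\<forall>x. h \<le> x \<and> x \<le> h0 \<longrightarrow> (\<exists>k<m. s ''cl'' k = x)" and gap: "\<forall>k<m. s ''cl'' k + 1 \<noteq> h"
  shows "load_gap E (load K (trees s)) (K - h)"
proof -
  have cl: "s ''cl'' k + load K (trees s) (ed k) = K" if "k < m" for k
    using F that by (simp add: family_inv_def ld_def)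
  have "K - h < (K - h0) + card E"
  proof (rule consecutive_loads_bound[where ld = "load K (trees s)"])
    fix x assume x: "K - h0 \<le> x" "x \<le> K - h"
    then have "h \<le> K - x" "K - x \<le> h0" "x \<le> K" using h by linarith+
    then obtain k where "k < m" "s ''cl'' k = K - x" using ex by blast
    then have "load K (trees s) (ed k) = x" using cl[of k] \<open>x \<le> K\<close> by linarith
    then show "\<exists>e\<in>E. load K (trees s) e = x" using \<open>k < m\<close> by blast
  qed
  moreover have "K - h0 \<le> load K (trees s) (ed k)" "load K (trees s) (ed k) \<noteq> Suc (K - h)" if "k < m" for k
  proof -
    have "s ''cl'' k \<le> h0" "s ''cl'' k + 1 \<noteq> h" using mx gap that by auto
    then show "K - h0 \<le> load K (trees s) (ed k)" "load K (trees s) (ed k) \<noteq> Suc (K - h)"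
      using cl[OF that] h by arith+
  qed
  moreover obtain k where "k < m" "s ''cl'' k = h" using ex h by blast
  then have "\<exists>e\<in>E. load K (trees s) e \<le> K - h" using cl[of k] by force
  ultimately show ?thesis unfolding load_gap_def by fastforce
qed

end

text \<open>The two squarings put \<open>m ^ 4 = K * m\<close> into \<open>lim\<close>, the value of
  \<open>base\<close> at which the scan is over.\<close>

definition solve_com :: com where
  "solve_com = Seq (times_com ''m'' ''m'' ''sq'') (Seq (times_com ''sq'' ''sq'' ''lim'')
     (Seq search_com (Seq (scan_edges max_body) (Seq (scan_edges gap_body) (scan_edges output_body)))))"

text \<open>Polymorphic, so that it can be read both as a number and as a polynomial.\<close>

definition time_bound :: "'a \<Rightarrow> 'a \<Rightarrow> 'a :: comm_semiring_1" where
  "time_bound n m = 100 * (m + 1) + (100 * (m * m + 1) +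
     ((m * (m ^ 3)\<^sup>2 * (m ^ 3 * m * m + m * m + 1) + (m ^ 3 * m * m + m * m) + 1) * (2000 * (n + 1) * (m + 1)) +
     (200 * (m + 1) + (200 * (m ^ 3 * (m + 1) + m + 1) + 200 * (m + 1)))))"

lemma time_bound_mono: "m \<le> m' \<Longrightarrow> time_bound n m \<le> time_bound n (m' :: nat)"
  unfolding time_bound_def by (intro add_mono mult_mono power_mono order_refl) auto

lemma poly_time_bound: "poly (time_bound p q) x = time_bound (poly p x) (poly q x)"
  by (simp only: time_bound_def poly_add poly_mult poly_power poly_1 poly_numeral)

context edge_list
begin

lemma initial_trees:
  assumes "s ''C'' = (\<lambda>_. 0)"
  shows "trees s i = E"
  using assms by (auto simp: trees_def)

lemma initial_invariants:
  assumes "s ''C'' = (\<lambda>_. 0)" "s ''cl'' = (\<lambda>_. 0)" "s ''base'' = (\<lambda>_. 0)" "s ''e'' = (\<lambda>_. 0)" "s ''f'' = (\<lambda>_. 0)"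
  shows "family_inv s" "scan_inv s"
proof -
  have "ld s k = K" if "k < m" for k
    using that by (simp add: ld_def load_def initial_trees[of s, OF assms(1)])
  then show "family_inv s" using assms connected by (simp add: family_inv_def initial_trees)
  show "scan_inv s" using assms m_pos by (auto simp: scan_inv_def position_def)
qed

text \<open>\<open>local_optimum_is_optimal\<close> in terms of edge indices: \<open>cl\<close> at
  least \<open>h\<close> means load at most \<open>K - h\<close>, and \<open>B\<close> selects the
  edges of member 0 among these.\<close>

lemma optimum_from_threshold:
  assumes F: "family_inv s" and lo: "locally_optimal {..<n} E K (trees s)"
    and gap: "load_gap E (load K (trees s)) (K - h)" and h: "h \<le> K"
  defines "L \<equiv> {l. l < m \<and> h \<le> s ''cl'' l}" and "B \<equiv> {l. l < m \<and> h \<le> s ''cl'' l \<and> s ''C'' l = 0}"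
  shows "indicator_weight (ed ` L) \<in> weightings E"
    "weighting_ratio {..<n} E (indicator_weight (ed ` L)) = min_weighting_ratio {..<n} E"
    "min_weighting_ratio {..<n} E = real (card B) / real (card L)" "0 < card L"
proof -
  have cl: "s ''cl'' k + load K (trees s) (ed k) = K" if "k < m" for k
    using F that by (simp add: family_inv_def ld_def)
  then have "load K (trees s) (ed k) \<le> K - h \<longleftrightarrow> h \<le> s ''cl'' k" if "k < m" for k
    using cl[OF that] h by arith
  then have L: "ed ` L = {e \<in> E. load K (trees s) e \<le> K - h}" by (auto simp: L_def)
  have inj: "inj_on ed {..<m}" using ed_eq_iff by (auto simp: inj_on_def)
  have "card E ^ 3 \<le> K" by (simp add: card_E K_def)
  note opt = local_optimum_is_optimal[OF lo gap this L]
  show "indicator_weight (ed ` L) \<in> weightings E"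
    "weighting_ratio {..<n} E (indicator_weight (ed ` L)) = min_weighting_ratio {..<n} E"
    using opt by simp_all
  have cL: "card (ed ` L) = card L" using inj by (intro card_image) (auto simp: L_def inj_on_def)
  have "trees s 0 \<inter> ed ` L = ed ` B" using ed_eq_iff by (auto simp: trees_def L_def B_def)
  moreover have "card (ed ` B) = card B" using inj by (intro card_image) (auto simp: B_def inj_on_def)
  ultimately show "min_weighting_ratio {..<n} E = real (card B) / real (card L)" using opt(4) cL by simp
  have "finite L" "L \<noteq> {}" using opt(1) by (auto simp: L_def)
  then show "0 < card L" by (simp add: card_gt_0_iff)
qed

lemma solve_runs:
  assumes inp: "is_input s" and zero: "\<And>x. x \<notin> {''n'', ''m'', ''src'', ''dst''} \<Longrightarrow> s x = (\<lambda>_. 0)"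
  shows "runs solve_com s (time_bound n m) (\<lambda>s'. \<exists>L\<subseteq>{..<m}.
    s' ''den'' 0 > 0 \<and> real (s' ''num'' 0) / real (s' ''den'' 0) = min_weighting_ratio {..<n} E \<and>
    indicator_weight (ed ` L) \<in> weightings E \<and>
    weighting_ratio {..<n} E (indicator_weight (ed ` L)) = min_weighting_ratio {..<n} E \<and>
    (\<forall>k<m. s' ''wden'' k = 1 \<and> s' ''wnum'' k = (if k \<in> L then 1 else 0)))" (is "runs _ _ _ ?post")
proof -
  let ?M = "{''mark'', ''k'', ''cnt'', ''C'', ''cl'', ''base'', ''e'', ''f''}"
  have nm: "s ''n'' 0 = n" "s ''m'' 0 = m" using inp by (simp_all add: is_input_def)
  let ?P1 = "\<lambda>s'. s' ''sq'' 0 = m * m \<and> (\<forall>w. w \<notin> {''sq'', ''k''} \<longrightarrow> s' w = s w)"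
  let ?P2 = "\<lambda>s'. s' ''lim'' 0 = K * m \<and> (\<forall>w. w \<notin> {''sq'', ''lim'', ''k''} \<longrightarrow> s' w = s w)"
  let ?P3 = "\<lambda>s'. family_inv s' \<and> locally_optimal {..<n} E K (trees s') \<and>
      s' ''m'' 0 = m \<and> s' ''h'' 0 = 0 \<and> s' ''num'' 0 = 0 \<and> s' ''den'' 0 = 0"
  have r1: "runs (times_com ''m'' ''m'' ''sq'') s (100 * (m + 1)) ?P1"
    using runs_times_com[of "''m''" "''sq''" "''m''" s m] nm by simp
  have r2: "runs (times_com ''sq'' ''sq'' ''lim'') s1 (100 * (m * m + 1)) ?P2" if s1: "?P1 s1" for s1
  proof (rule runs_mono[OF runs_times_com[of "''sq''" "''lim''" "''sq''" s1 "m * m"]])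
    fix s' assume "s' ''lim'' 0 = s1 ''sq'' 0 * s1 ''sq'' 0 \<and> (\<forall>w. w \<notin> {''lim'', ''k''} \<longrightarrow> s' w = s1 w)"
    then show "?P2 s'" using s1 by (simp add: K_def power3_eq_cube)
  qed (use s1 in simp_all)
  have r3: "runs search_com s2 ((search_bound + 1) * (2000 * (n + 1) * (m + 1))) ?P3" if s2: "?P2 s2" for s2
  proof (rule runs_mono[OF search_runs])
    show "is_input s2" using inp s2 by (simp add: is_input_def)
    show "family_inv s2" "scan_inv s2" by (rule initial_invariants; use s2 zero in simp)+
    show "s2 ''lim'' 0 = K * m" using s2 by simp
    fix s' assume a: "family_inv s' \<and> locally_optimal {..<n} E K (trees s') \<and>
       (\<forall>w. w \<notin> ?M \<longrightarrow> s' w = s2 w)"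
    then show "?P3 s'" using s2 nm zero by simp
  qed simp
  have r456: "runs (Seq (scan_edges max_body) (Seq (scan_edges gap_body) (scan_edges output_body))) s3
     (200 * (m + 1) + (200 * (K * (m + 1) + m + 1) + 200 * (m + 1))) ?post" if s3: "?P3 s3" for s3
  proof -
    have F: "family_inv s3" and lo: "locally_optimal {..<n} E K (trees s3)" using s3 by simp_all
    let ?P4 = "\<lambda>s'. (\<forall>k<m. s3 ''cl'' k \<le> s' ''h'' 0) \<and> (\<exists>k<m. s3 ''cl'' k = s' ''h'' 0) \<and>
       (\<forall>x. x \<notin> {''h'', ''k''} \<longrightarrow> s' x = s3 x)"
    show ?thesis
    proof (rule runs_Seq[where P = ?P4])
      show "runs (scan_edges max_body) s3 (200 * (m + 1)) ?P4" by (rule max_runs) (use s3 in simp_all)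
      fix s4 assume s4: "?P4 s4"
      define h0 where "h0 = s4 ''h'' 0"
      have eq4: "s4 ''cl'' = s3 ''cl''" "s4 ''C'' = s3 ''C''" "s4 ''m'' 0 = m" "s4 ''num'' 0 = 0" "s4 ''den'' 0 = 0"
        using s4 s3 by simp_all
      have mx: "\<forall>k<m. s3 ''cl'' k \<le> h0" and ex0: "\<exists>k<m. s3 ''cl'' k = h0" using s4 by (simp_all add: h0_def)
      have h0K: "h0 \<le> K" using ex0 F by (auto simp: family_inv_def)
      let ?P5 = "\<lambda>s'. s' ''h'' 0 \<le> h0 \<and> (\<forall>x. s' ''h'' 0 \<le> x \<and> x \<le> h0 \<longrightarrow> (\<exists>k<m. s4 ''cl'' k = x)) \<and>
         (\<forall>k<m. s4 ''cl'' k + 1 \<noteq> s' ''h'' 0) \<and> (\<forall>x. x \<notin> {''h'', ''k''} \<longrightarrow> s' x = s4 x)"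
      show "runs (Seq (scan_edges gap_body) (scan_edges output_body)) s4
         (200 * (K * (m + 1) + m + 1) + 200 * (m + 1)) ?post"
      proof (rule runs_Seq[where P = ?P5])
        show "runs (scan_edges gap_body) s4 (200 * (K * (m + 1) + m + 1)) ?P5"
          by (rule gap_runs) (use eq4 h0K ex0 in \<open>simp_all add: h0_def\<close>)
        fix s5 assume s5: "?P5 s5"
        define h where "h = s5 ''h'' 0"
        have eq5: "s5 ''cl'' = s3 ''cl''" "s5 ''C'' = s3 ''C''" "s5 ''m'' 0 = m" "s5 ''num'' 0 = 0" "s5 ''den'' 0 = 0"
          using s5 eq4 by simp_all
        have hh: "h \<le> h0" and ex: "\<forall>x. h \<le> x \<and> x \<le> h0 \<longrightarrow> (\<exists>k<m. s3 ''cl'' k = x)"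
          and ne: "\<forall>k<m. s3 ''cl'' k + 1 \<noteq> h" using s5 unfolding eq4(1) h_def[symmetric] by blast+
        have gap: "load_gap E (load K (trees s3)) (K - h)"
          by (rule threshold_load_gap[of s3, OF F hh h0K mx ex ne])
        note opt = optimum_from_threshold[of s3, OF F lo gap le_trans[OF hh h0K]]
        have C: "\<forall>q. s5 ''C'' q \<le> 1" using F by (simp add: eq5 family_inv_def)
        show "runs (scan_edges output_body) s5 (200 * (m + 1)) ?post"
        proof (rule runs_mono[OF output_runs[of s5, OF eq5(3-5) C]])
          fix s' assume out: "s' ''den'' 0 = card {l. l < m \<and> s5 ''h'' 0 \<le> s5 ''cl'' l} \<and>
            s' ''num'' 0 = card {l. l < m \<and> s5 ''h'' 0 \<le> s5 ''cl'' l \<and> s5 ''C'' l = 0} \<and>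
            (\<forall>l<m. s' ''wden'' l = 1 \<and> s' ''wnum'' l = (if s5 ''h'' 0 \<le> s5 ''cl'' l then 1 else 0))"
          show "?post s'"
            using out opt unfolding eq5(1,2) h_def[symmetric]
            by (intro exI[of _ "{l. l < m \<and> h \<le> s3 ''cl'' l}"]) auto
        qed simp
      qed
    qed
  qed
  show ?thesis
    unfolding solve_com_def
    by (rule runs_mono[OF runs_Seq[OF r1 runs_Seq[OF r2 runs_Seq[OF r3 r456]]]])
      (simp_all add: time_bound_def search_bound_def K_def)
qed

end

section \<open>From input lists to the solved problem\<close>

lemma input_edge_list:
  assumes sg: "simple_graph {..<n} E" and con: "graph_connected {..<n} E" and ne: "E \<noteq> {}" and el: "edge_listing es E"
  shows "edge_list n (length es) (\<lambda>k. fst (es ! k)) (\<lambda>k. snd (es ! k))"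
    and "(\<lambda>k. {fst (es ! k), snd (es ! k)}) ` {..<length es} = E"
proof -
  let ?g = "\<lambda>(u, v). {u, v}"
  have di: "distinct (map ?g es)" and set: "set (map ?g es) = E" using el by (simp_all add: edge_listing_def)
  have nth: "map ?g es ! k = {fst (es ! k), snd (es ! k)}" if "k < length es" for k
    using that by (simp add: case_prod_beta)
  show img: "(\<lambda>k. {fst (es ! k), snd (es ! k)}) ` {..<length es} = E"
  proof -
    have "E = (\<lambda>k. map ?g es ! k) ` {..<length es}"
      using set by (metis length_map atLeast0LessThan list.set_map map_nth set_upt image_set)
    also have "\<dots> = (\<lambda>k. {fst (es ! k), snd (es ! k)}) ` {..<length es}" using nth by (intro image_cong) auto
    finally show ?thesis by simp
  qed
  show "edge_list n (length es) (\<lambda>k. fst (es ! k)) (\<lambda>k. snd (es ! k))"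
  proof
    fix k assume "k < length es"
    then have "{fst (es ! k), snd (es ! k)} \<in> E" using img by blast
    then show "fst (es ! k) < n \<and> snd (es ! k) < n \<and> fst (es ! k) \<noteq> snd (es ! k)"
      using sg by (fastforce simp: simple_graph_def doubleton_eq_iff)
  next
    show "inj_on (\<lambda>k. {fst (es ! k), snd (es ! k)}) {..<length es}"
      using di nth by (auto simp: inj_on_def distinct_conv_nth)
    show "0 < length es" using img ne by auto
    show "graph_connected {..<n} ((\<lambda>k. {fst (es ! k), snd (es ! k)}) ` {..<length es})" using img con by simp
  qed
qed

theorem theorem2:
  "\<exists>(c :: com) (p :: nat poly). \<forall>(n :: nat) (E :: nat set set) (es :: (nat \<times> nat) list).
     simple_graph {..<n} E \<and> graph_connected {..<n} E \<and> E \<noteq> {} \<and> edge_listing es E \<longrightarrow>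
     (\<exists>t s'. exec c (input_state n es) t s' \<and> t \<le> poly p n \<and>
        solves_min_weighting_ratio {..<n} E es s')"
proof (rule exI[of _ solve_com], rule exI[of _ "time_bound [:0, 1:] ([:0, 1:] * [:0, 1:])"], intro allI impI)
  fix n :: nat and E :: "nat set set" and es :: "(nat \<times> nat) list"
  assume a: "simple_graph {..<n} E \<and> graph_connected {..<n} E \<and> E \<noteq> {} \<and> edge_listing es E"
  let ?m = "length es" and ?s = "input_state n es"
  interpret edge_list n ?m "\<lambda>k. fst (es ! k)" "\<lambda>k. snd (es ! k)"
    using a by (intro input_edge_list) auto
  have ed: "ed = (\<lambda>k. {fst (es ! k), snd (es ! k)})" by (simp add: ed_def fun_eq_iff)
  have E: "ed ` {..<?m} = E" unfolding ed using a by (intro input_edge_list) auto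
  have "is_input ?s" by (simp add: is_input_def input_state_def)
  moreover have "?s x = (\<lambda>_. 0)" if "x \<notin> {''n'', ''m'', ''src'', ''dst''}" for x
    using that by (auto simp: input_state_def)
  ultimately obtain t s' L where ex: "exec solve_com ?s t s'" and t: "t \<le> time_bound n ?m"
    and L: "L \<subseteq> {..<?m}" and den: "s' ''den'' 0 > 0"
      "real (s' ''num'' 0) / real (s' ''den'' 0) = min_weighting_ratio {..<n} E"
    and w: "indicator_weight (ed ` L) \<in> weightings E"
      "weighting_ratio {..<n} E (indicator_weight (ed ` L)) = min_weighting_ratio {..<n} E"
    and out: "\<forall>k<?m. s' ''wden'' k = 1 \<and> s' ''wnum'' k = (if k \<in> L then 1 else 0)"
    using solve_runs[of ?s] unfolding runs_def E by blast
  have "indicator_weight (ed ` L) {fst (es ! k), snd (es ! k)} = real (s' ''wnum'' k) / real (s' ''wden'' k)"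
    if "k < ?m" for k
  proof -
    have "ed k \<in> ed ` L \<longleftrightarrow> k \<in> L" using L that ed_eq_iff by blast
    then show ?thesis using out that by (simp add: indicator_weight_def ed)
  qed
  then have "solves_min_weighting_ratio {..<n} E es s'"
    unfolding solves_min_weighting_ratio_def using den w out by (intro conjI bexI[OF _ w(1)]) auto
  \<comment> \<open>\<open>[:0, 1:]\<close> is the identity polynomial, so the bound evaluates to
    \<open>time_bound n (n * n)\<close>, where \<open>n * n\<close> bounds the number of
    edges.\<close>
  moreover have "t \<le> poly (time_bound [:0, 1:] ([:0, 1:] * [:0, 1:])) n"
    using t time_bound_mono[OF m_le, of n] by (simp add: poly_time_bound)
  ultimately show "\<exists>t s'. exec solve_com ?s t s' \<and> t \<le> poly (time_bound [:0, 1:] ([:0, 1:] * [:0, 1:])) n \<and>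
      solves_min_weighting_ratio {..<n} E es s'" using ex by blast
qed

end
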